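(* Let $a,b$ be integers with $1<a\le b$ and $c=\mathrm{lcm}(a,b)\le6$, and let $q$ be a prime power with $q\equiv1\pmod c$. Then there exist orthogonal orthomorphisms $\theta\in\mathscr{D}_a(q)$ and $\theta'\in\mathscr{D}_b(q)$ if and only if $q>7$ and $(q,a,b)\notin\{(9,2,4),\,(13,2,3),\,(13,2,6)\}$.
   Context: Let $\mathbb{F}_q$ be the finite field of order $q$. An orthomorphism is a permutation $\theta$ of $\mathbb{F}_q$ such that $x\mapsto\theta(x)-x$ is also a permutation. Two orthomorphisms $\theta,\theta'$ are orthogonal if $x\mapsto\theta(x)-\theta'(x)$ is a permutation. For $k\mid(q-1)$, fix a generator $g$ of $\mathbb{F}_q^*$ and let $C_{k,i}=\{g^j: j\equiv i\pmod k\}$, $0\le i<k$. A cyclotomic map of index $k$ with multipliers $[a_0,\dots,a_{k-1}]$ is $\theta(0)=0$, $\theta(x)=a_ix$ for $x\in C_{k,i}$. $\mathscr{C}_k(q)$ is the set of orthomorphisms that are cyclotomic maps of index $k$, and $\mathscr{D}_k(q)=\mathscr{C}_k(q)\setminus\bigcup_{\ell<k,\ \ell\mid(q-1)}\mathscr{C}_\ell(q)$. *)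

theory Defs
  imports "HOL-Number_Theory.Number_Theory" "HOL-Library.Cardinality"
begin

text \<open>The field of order \<open>q\<close> is a type \<open>'a\<close> of class \<open>{field, finite}\<close> with \<open>CARD('a) = q\<close>.\<close>

definition orthomorphism :: "('a::{field,finite} \<Rightarrow> 'a) \<Rightarrow> bool" where
  "orthomorphism \<theta> \<longleftrightarrow> bij \<theta> \<and> bij (\<lambda>x. \<theta> x - x)"

definition orthogonal_orthomorphisms ::
  "('a::{field,finite} \<Rightarrow> 'a) \<Rightarrow> ('a \<Rightarrow> 'a) \<Rightarrow> bool" where
  "orthogonal_orthomorphisms \<theta> \<theta>' \<longleftrightarrow>
     orthomorphism \<theta> \<and> orthomorphism \<theta>' \<and> bij (\<lambda>x. \<theta> x - \<theta>' x)"

definition field_generator :: "'a::{field,finite} \<Rightarrow> bool" where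
  "field_generator g \<longleftrightarrow> range (\<lambda>j::nat. g ^ j) = UNIV - {0}"

text \<open>The notions below depend on a generator \<open>g\<close> of the multiplicative group and are meant for
  \<open>k dvd CARD('a) - 1\<close>. Then natural exponents give the same classes as integer ones, since
  \<open>g ^ (CARD('a) - 1) = 1\<close>.\<close>

definition cyclotomic_class :: "'a::{field,finite} \<Rightarrow> nat \<Rightarrow> nat \<Rightarrow> 'a set" where
  "cyclotomic_class g k i = {g ^ j | j::nat. [j = i] (mod k)}"

text \<open>Only the multipliers \<open>m 0, \<dots>, m (k - 1)\<close> matter.\<close>

definition is_cyclotomic_map ::
  "'a::{field,finite} \<Rightarrow> nat \<Rightarrow> (nat \<Rightarrow> 'a) \<Rightarrow> ('a \<Rightarrow> 'a) \<Rightarrow> bool" where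
  "is_cyclotomic_map g k m \<theta> \<longleftrightarrow>
     \<theta> 0 = 0 \<and> (\<forall>i<k. \<forall>x\<in>cyclotomic_class g k i. \<theta> x = m i * x)"

definition cyclotomic_orthomorphisms :: "'a::{field,finite} \<Rightarrow> nat \<Rightarrow> ('a \<Rightarrow> 'a) set" where
  "cyclotomic_orthomorphisms g k =
     {\<theta>. orthomorphism \<theta> \<and> (\<exists>m. is_cyclotomic_map g k m \<theta>)}"

definition least_index_orthomorphisms :: "'a::{field,finite} \<Rightarrow> nat \<Rightarrow> ('a \<Rightarrow> 'a) set" where
  "least_index_orthomorphisms g k =
     cyclotomic_orthomorphisms g k -
     (\<Union>l\<in>{l. l < k \<and> l dvd CARD('a) - 1}. cyclotomic_orthomorphisms g l)"

end

(*
  Maps of index k are written as x * F (x^M), where k * M = q - 1 and F is a function on the k-th roots of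
  unity; such a map is bijective as soon as z * F(z)^M is injective on these roots. If F differs
  from a constant only at 1 and its two values lie in one class, this holds. So two such maps with multipliers u, u'
  and v, v' give an orthogonal pair once u/u', (u - 1)/(u' - 1), v/v', (v - 1)/(v' - 1) and the ratios
  of the occurring differences of a u-value and a v-value are power residues. For large q the pigeonhole principle
  provides such quadruples: if a = b, by the choice v = 1/u, v' = 1/u'; otherwise among the roughly
  (q - 1)/c elements u for which u - v and u - v' lie in the same class, v and v' being fixed. No character sum
  estimate is needed, and the bounds (at most 343) leave few fields, where explicit multipliers are
  verified. The negative cases are settled by exhaustive search.
*)
theory Submission
  imports Defs "HOL-Computational_Algebra.Polynomial"
begin

section \<open>Power residues in a finite field\<close>

text \<open>Two obstacles shape the development. First, the field is an arbitrary type of the given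
  cardinality, so nothing can be evaluated in it. Computations run on integer pairs and are carried
  over by the homomorphism \<open>ext_value\<close>: equal pairs have equal values, while an
  inequality is certified by a (q-1)-th power equal to 1. Where a quadratic extension is used, a
  suitable \<alpha> exists by Euler's criterion or as a cube root of unity. Pairs reach only
  elements of degree at most 2 over the prime field; for q = 16 and q = 343 powers of the Frobenius
  map supply the second multipliers. Second, the searches must stay small. For q at most 7 all
  orthomorphisms fixing 0 are searched, and of two orthogonal ones at least one turns out to be
  linear. For q = 9 and q = 13 the map of index 2 has only two multipliers to try, and (q-1)/b is
  even, which makes both maps odd: each is determined by one argument out of each pair x, -x, and
  injectivity can be tested on squares.\<close>

lemma nonzero_power_card:
  fixes x :: "'a::{field,finite}"
  assumes "x \<noteq> 0"
  shows "x ^ (CARD('a) - 1) = 1"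
proof -
  let ?A = "UNIV - {0::'a}"
  have "bij_betw (\<lambda>y. x * y) ?A ?A"
    by (rule bij_betwI[where g = "\<lambda>y. y / x"]) (use assms in auto)
  then have "prod id ?A = (\<Prod>y\<in>?A. x * y)"
    using prod.reindex_bij_betw[of "\<lambda>y. x * y" ?A ?A id] by simp
  also have "\<dots> = x ^ (CARD('a) - 1) * prod id ?A"
    by (simp add: prod.distrib card_Diff_singleton)
  finally show ?thesis
    by simp
qed

lemma card_roots_of_unity_le:
  assumes "k > 0"
  shows "card {z::'a::{field,finite}. z ^ k = 1} \<le> k"
proof -
  let ?p = "monom 1 k - 1 :: 'a poly"
  have "coeff ?p k = 1"
    using assms by simp
  then have "?p \<noteq> 0"
    by (metis coeff_0 zero_neq_one)
  moreover have "degree ?p \<le> k"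
    by (intro degree_diff_le) (simp_all add: degree_monom_le)
  moreover have "{z. poly ?p z = 0} = {z. z ^ k = 1}"
    by (simp add: poly_monom)
  ultimately show ?thesis
    using card_poly_roots_bound[of ?p] by force
qed

lemma card_field_gt_1: "CARD('a::{field,finite}) > 1"
  using card_mono[of UNIV "{0, 1::'a}"] by simp

lemma index_factors_pos:
  assumes "k * M = CARD('a::{field,finite}) - 1"
  shows "k > 0" "M > 0"
  using assms card_field_gt_1[where 'a = 'a] by (cases k; cases M; simp)+

text \<open>Cyclotomic maps of index \<open>(CARD('a) - 1) / M\<close>, described without a generator.\<close>

definition index_map :: "nat \<Rightarrow> ('a::field \<Rightarrow> 'a) \<Rightarrow> bool" where
  "index_map M \<theta> \<longleftrightarrow> \<theta> 0 = 0 \<and> (\<forall>x y. x \<noteq> 0 \<longrightarrow> y \<noteq> 0 \<longrightarrow> x ^ M = y ^ M \<longrightarrow> \<theta> x * y = \<theta> y * x)"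

definition residue_map :: "nat \<Rightarrow> ('a::field \<Rightarrow> 'a) \<Rightarrow> 'a \<Rightarrow> 'a" where
  "residue_map M F x = x * F (x ^ M)"

definition admissible :: "nat \<Rightarrow> nat \<Rightarrow> ('a::field \<Rightarrow> 'a) \<Rightarrow> bool" where
  "admissible k M F \<longleftrightarrow>
     (\<forall>z. z ^ k = 1 \<longrightarrow> F z \<noteq> 0) \<and> inj_on (\<lambda>z. z * F z ^ M) {z. z ^ k = 1}"

definition has_orthogonal_pair :: "'a::{field,finite} \<Rightarrow> nat \<Rightarrow> nat \<Rightarrow> bool" where
  "has_orthogonal_pair g a b \<longleftrightarrow>
     (\<exists>\<theta>\<in>least_index_orthomorphisms g a. \<exists>\<theta>'\<in>least_index_orthomorphisms g b.
        orthogonal_orthomorphisms \<theta> \<theta>')"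

context
  fixes g :: "'a::{field,finite}"
  assumes gen: "field_generator g"
begin

lemma generator_nonzero: "g \<noteq> 0"
proof
  assume "g = 0"
  moreover have "g ^ 1 \<in> UNIV - {0}"
    using gen unfolding field_generator_def by blast
  ultimately show False by simp
qed

lemma obtain_log:
  assumes "x \<noteq> 0"
  obtains j where "x = g ^ j"
  using assms gen unfolding field_generator_def by blast

text \<open>The powers with exponents below \<open>CARD('a) - 1\<close> already hit all nonzero
  elements. There are as many exponents as elements, so no two of these powers agree.\<close>

lemma generator_power_eq_iff: "g ^ i = g ^ j \<longleftrightarrow> [i = j] (mod (CARD('a) - 1))"
proof -
  let ?n = "CARD('a) - 1"
  have n: "?n > 0" using card_field_gt_1 by simp
  have red: "g ^ i = g ^ (i mod ?n)" for i
  proof -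
    have "g ^ i = (g ^ ?n) ^ (i div ?n) * g ^ (i mod ?n)"
      by (simp flip: power_mult power_add)
    then show ?thesis using nonzero_power_card[OF generator_nonzero] by simp
  qed
  have "(\<lambda>j. g ^ j) ` {..<?n} = UNIV - {0}"
  proof -
    have "(\<lambda>j. g ^ j) ` {..<?n} = range (\<lambda>j. g ^ j)"
    proof (rule subset_antisym; rule image_subsetI)
      fix j :: nat show "g ^ j \<in> (\<lambda>j. g ^ j) ` {..<?n}"
        using n red[of j] by (intro image_eqI[where x = "j mod ?n"]) auto
    next
      fix j show "g ^ j \<in> range (\<lambda>j. g ^ j)" by blast
    qed
    then show ?thesis using gen by (simp add: field_generator_def)
  qed
  then have "inj_on (\<lambda>j. g ^ j) {..<?n}"
    by (intro eq_card_imp_inj_on) (auto simp: card_Diff_singleton)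
  then have "g ^ (i mod ?n) = g ^ (j mod ?n) \<longleftrightarrow> i mod ?n = j mod ?n"
    using n by (auto dest: inj_onD)
  then show ?thesis using red by (metis cong_def)
qed

lemma generator_power_residue_eq_iff:
  assumes "k * M = CARD('a) - 1"
  shows "(g ^ i) ^ M = (g ^ j) ^ M \<longleftrightarrow> [i = j] (mod k)"
proof -
  have "M > 0" using index_factors_pos assms by blast
  then show ?thesis
    unfolding generator_power_eq_iff power_mult[symmetric] assms[symmetric] cong_def
    by (simp add: mod_mult_mult2)
qed

text \<open>With z = g^j, the equation z^k = 1 forces k M to divide j k, hence M to divide
  j.\<close>

lemma obtain_power_residue:
  fixes z :: 'a
  assumes "k * M = CARD('a) - 1" "z ^ k = 1"
  obtains x where "x \<noteq> 0" "x ^ M = z"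
proof -
  have k: "k > 0" using index_factors_pos assms by blast
  have "z \<noteq> 0" using k assms(2) by (metis not_gr0 power_0_left zero_neq_one)
  then obtain j where j: "z = g ^ j" by (rule obtain_log)
  have "g ^ (j * k) = g ^ 0" using assms(2) j by (simp add: power_mult)
  then have "k * M dvd j * k"
    unfolding generator_power_eq_iff assms(1) by (simp add: cong_0_iff)
  then have "M dvd j" using k by (simp add: mult.commute)
  then obtain i where "j = M * i" ..
  then have "(g ^ i) ^ M = z" using j by (simp add: mult.commute flip: power_mult)
  moreover have "g ^ i \<noteq> 0" using generator_nonzero by simp
  ultimately show ?thesis using that by blast
qed

lemma power_residue_root:
  assumes "k * M = CARD('a) - 1" "x \<noteq> 0"
  shows "(x ^ M) ^ k = (1::'a)"
  using nonzero_power_card[OF assms(2)] assms(1) by (simp add: mult.commute flip: power_mult)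

text \<open>The powers of g^k give M solutions, and a polynomial of degree M has no more
  roots.\<close>

lemma card_power_residues:
  assumes "k * M = CARD('a) - 1"
  shows "card {z::'a. z ^ M = 1} = M"
proof -
  note k = index_factors_pos(1)[OF assms] and M = index_factors_pos(2)[OF assms]
  have "inj_on (\<lambda>i. g ^ (k * i)) {..<M}"
  proof (rule inj_onI)
    fix i j assume ij: "i \<in> {..<M}" "j \<in> {..<M}" and "g ^ (k * i) = g ^ (k * j)"
    then have "k * i mod (k * M) = k * j mod (k * M)"
      unfolding generator_power_eq_iff assms cong_def by simp
    then show "i = j" using ij k by (simp add: mod_mult_mult1)
  qed
  moreover have "(\<lambda>i. g ^ (k * i)) ` {..<M} \<subseteq> {z. z ^ M = 1}"
    using power_residue_root[of M k "g ^ i" for i] assms generator_nonzero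
    by (auto simp: mult.commute simp flip: power_mult)
  ultimately have "M \<le> card {z::'a. z ^ M = 1}"
    by (metis card_image card_lessThan card_mono finite)
  then show ?thesis using card_roots_of_unity_le[OF M, where ?'a = 'a] by simp
qed

section \<open>Cyclotomic maps without a generator\<close>

text \<open>By \<open>generator_power_residue_eq_iff\<close> the class of x is determined by x^M,
  which frees what follows from the exponents of g. The multiplier of class i is read off at
  g^i.\<close>

lemma is_cyclotomic_map_iff:
  assumes kM: "k * M = CARD('a) - 1"
  shows "(\<exists>m. is_cyclotomic_map g k m \<theta>) \<longleftrightarrow> index_map M \<theta>"
proof
  have k: "k > 0" using index_factors_pos assms by blast
  {
    assume "\<exists>m. is_cyclotomic_map g k m \<theta>"
    then obtain m where m: "\<theta> 0 = 0" "\<And>i x. i < k \<Longrightarrow> x \<in> cyclotomic_class g k i \<Longrightarrow> \<theta> x = m i * x"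
      unfolding is_cyclotomic_map_def by blast
    have val: "\<theta> (g ^ i) = m (i mod k) * g ^ i" for i
      using k by (intro m(2)) (auto simp: cyclotomic_class_def cong_def)
    show "index_map M \<theta>"
      unfolding index_map_def
    proof (intro conjI allI impI)
      fix x y :: 'a assume "x \<noteq> 0" "y \<noteq> 0" and eq: "x ^ M = y ^ M"
      then obtain i j where ij: "x = g ^ i" "y = g ^ j" using obtain_log by metis
      then have "i mod k = j mod k"
        using generator_power_residue_eq_iff[OF kM] eq by (simp add: cong_def)
      then show "\<theta> x * y = \<theta> y * x" by (simp add: ij val)
    qed (fact m(1))
  }
  {
    assume ind: "index_map M \<theta>"
    have "is_cyclotomic_map g k (\<lambda>i. \<theta> (g ^ i) / g ^ i) \<theta>"
      unfolding is_cyclotomic_map_def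
    proof (intro conjI allI impI ballI)
      show "\<theta> 0 = 0" using ind by (simp add: index_map_def)
      fix i x assume "i < k" "x \<in> cyclotomic_class g k i"
      then obtain j where j: "x = g ^ j" "[j = i] (mod k)" by (auto simp: cyclotomic_class_def)
      then have "(g ^ j) ^ M = (g ^ i) ^ M" using generator_power_residue_eq_iff[OF kM] by simp
      then have "\<theta> x * g ^ i = \<theta> (g ^ i) * x"
        using ind generator_nonzero unfolding index_map_def j(1) by simp
      then show "\<theta> x = \<theta> (g ^ i) / g ^ i * x" using generator_nonzero by (simp add: field_simps)
    qed
    then show "\<exists>m. is_cyclotomic_map g k m \<theta>" by blast
  }
qed

lemma cyclotomic_orthomorphisms_iff:
  assumes "k * M = CARD('a) - 1"
  shows "\<theta> \<in> cyclotomic_orthomorphisms g k \<longleftrightarrow> orthomorphism \<theta> \<and> index_map M \<theta>"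
  using is_cyclotomic_map_iff[OF assms] by (simp add: cyclotomic_orthomorphisms_def)

section \<open>Constructing orthogonal pairs\<close>

text \<open>The M-th powers of two equal values give equal z * F(z)^M, so both arguments have the
  same M-th power z. On such arguments the map is multiplication by the nonzero constant
  F(z).\<close>

lemma bij_residue_map:
  fixes F :: "'a \<Rightarrow> 'a"
  assumes kM: "k * M = CARD('a) - 1" and F: "admissible k M F"
  shows "bij (residue_map M F)"
proof -
  have "inj (residue_map M F)"
  proof (rule injI)
    fix x y assume eq: "residue_map M F x = residue_map M F y"
    have nz: "residue_map M F x = 0 \<longleftrightarrow> x = 0" for x
      using F power_residue_root[OF kM, of x] by (auto simp: residue_map_def admissible_def)
    show "x = y"
    proof (cases "x = 0 \<or> y = 0")
      case True
      then show ?thesis using nz eq by metis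
    next
      case False
      then have xy: "(x ^ M) ^ k = 1" "(y ^ M) ^ k = 1" using power_residue_root[OF kM] by auto
      have "x ^ M * F (x ^ M) ^ M = y ^ M * F (y ^ M) ^ M"
        using eq by (simp add: residue_map_def flip: power_mult_distrib)
      then have "x ^ M = y ^ M" using F xy unfolding admissible_def inj_on_def by blast
      then show ?thesis using eq F xy by (auto simp: residue_map_def admissible_def)
    qed
  qed
  then show ?thesis by (simp add: bij_def finite_UNIV_inj_surj)
qed

text \<open>If the map also had index l, its ratio to the identity would not change under x -> x *
  y^l, because y^l has (q-1)/l-th power 1. On M-th powers this makes F invariant under
  multiplication by every w^l, against \<open>least\<close>.\<close>

lemma least_index_residue_map:
  fixes F :: "'a \<Rightarrow> 'a"
  assumes aM: "a * M = CARD('a) - 1"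
    and F: "admissible a M F" "admissible a M (\<lambda>z. F z - 1)"
    and least: "\<And>l. 0 < l \<Longrightarrow> l < a \<Longrightarrow> \<exists>z w. z ^ a = 1 \<and> w ^ a = 1 \<and> F (z * w ^ l) \<noteq> F z"
  shows "residue_map M F \<in> least_index_orthomorphisms g a"
proof -
  have "residue_map M F x - x = residue_map M (\<lambda>z. F z - 1) x" for x
    by (simp add: residue_map_def algebra_simps)
  then have orth: "orthomorphism (residue_map M F)"
    using bij_residue_map[OF aM F(1)] bij_residue_map[OF aM F(2)] by (simp add: orthomorphism_def)
  have "M > 0" using index_factors_pos[OF aM] by simp
  then have "index_map M (residue_map M F)" by (simp add: index_map_def residue_map_def)
  then have "residue_map M F \<in> cyclotomic_orthomorphisms g a"
    using orth by (simp add: cyclotomic_orthomorphisms_iff[OF aM])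
  moreover have "residue_map M F \<notin> cyclotomic_orthomorphisms g l"
    if l: "l < a" "l dvd CARD('a) - 1" for l
  proof
    assume *: "residue_map M F \<in> cyclotomic_orthomorphisms g l"
    have lM: "l * ((CARD('a) - 1) div l) = CARD('a) - 1" using l by simp
    have "l > 0" using index_factors_pos[OF lM] by simp
    then obtain z w where zw: "z ^ a = 1" "w ^ a = 1" "F (z * w ^ l) \<noteq> F z" using least l by metis
    obtain x where x: "x \<noteq> 0" "x ^ M = z" using obtain_power_residue[OF aM zw(1)] .
    obtain y where y: "y \<noteq> 0" "y ^ M = w" using obtain_power_residue[OF aM zw(2)] .
    let ?m = "(CARD('a) - 1) div l"
    have "(x * y ^ l) ^ ?m = x ^ ?m"
      using nonzero_power_card[OF y(1)] lM by (simp add: power_mult_distrib flip: power_mult)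
    then have "residue_map M F (x * y ^ l) * x = residue_map M F x * (x * y ^ l)"
      using * x y unfolding cyclotomic_orthomorphisms_iff[OF lM] index_map_def by simp
    then have "F ((x * y ^ l) ^ M) = F (x ^ M)"
      using x y by (simp add: residue_map_def)
    moreover have "(x * y ^ l) ^ M = z * w ^ l"
      using x y by (simp add: power_mult_distrib power_commutes flip: power_mult)
         (metis mult.commute power_mult)
    ultimately show False using zw(3) x by simp
  qed
  ultimately show ?thesis by (auto simp: least_index_orthomorphisms_def)
qed

text \<open>Since x^(a' M) = (x^M)^a', both multipliers are functions of x^M. The difference of the
  maps is therefore a \<open>residue_map\<close> of the common index c.\<close>

lemma has_orthogonal_pairI:
  fixes F G :: "'a \<Rightarrow> 'a"
  assumes c: "c * M = CARD('a) - 1" "a * a' = c" "b * b' = c"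
    and F: "admissible a (a' * M) F" "admissible a (a' * M) (\<lambda>z. F z - 1)"
    and G: "admissible b (b' * M) G" "admissible b (b' * M) (\<lambda>z. G z - 1)"
    and FG: "admissible c M (\<lambda>z. F (z ^ a') - G (z ^ b'))"
    and least_F: "\<And>l. 0 < l \<Longrightarrow> l < a \<Longrightarrow> \<exists>z w. z ^ a = 1 \<and> w ^ a = 1 \<and> F (z * w ^ l) \<noteq> F z"
    and least_G: "\<And>l. 0 < l \<Longrightarrow> l < b \<Longrightarrow> \<exists>z w. z ^ b = 1 \<and> w ^ b = 1 \<and> G (z * w ^ l) \<noteq> G z"
  shows "has_orthogonal_pair g a b"
proof -
  let ?\<theta> = "residue_map (a' * M) F" and ?\<theta>' = "residue_map (b' * M) G"
  have 1: "a * (a' * M) = CARD('a) - 1" "b * (b' * M) = CARD('a) - 1"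
    using c by (simp_all flip: mult.assoc)
  have 2: "?\<theta> \<in> least_index_orthomorphisms g a" "?\<theta>' \<in> least_index_orthomorphisms g b"
    using least_index_residue_map[OF 1(1) F least_F] least_index_residue_map[OF 1(2) G least_G] by auto
  have "?\<theta> x - ?\<theta>' x = residue_map M (\<lambda>z. F (z ^ a') - G (z ^ b')) x" for x
    by (simp add: residue_map_def algebra_simps power_mult mult.commute flip: power_mult)
  then have "bij (\<lambda>x. ?\<theta> x - ?\<theta>' x)" using bij_residue_map[OF c(1) FG] by simp
  then have "orthogonal_orthomorphisms ?\<theta> ?\<theta>'"
    using 2 by (auto simp: orthogonal_orthomorphisms_def least_index_orthomorphisms_def
        cyclotomic_orthomorphisms_def)
  then show ?thesis using 2 unfolding has_orthogonal_pair_def by blast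
qed

end

context
  fixes g :: "'a::{field,finite}"
  assumes gen: "field_generator g"
begin

section \<open>Pairs with two multipliers each\<close>

lemma admissible_if_power_const:
  fixes F :: "'a \<Rightarrow> 'a"
  assumes "M > 0" "D \<noteq> 0" "\<And>z. z ^ k = 1 \<Longrightarrow> F z ^ M = D"
  shows "admissible k M F"
  unfolding admissible_def
proof (intro conjI allI impI inj_onI)
  fix z :: 'a assume "z ^ k = 1"
  then show "F z \<noteq> 0" using assms by (metis power_0_left not_gr0)
qed (use assms in auto)

text \<open>Take z = 1 and w = g^M, which has order a: for 0 < l < a the power w^l differs from 1,
  the only place where the multiplier is u'.\<close>

lemma two_multipliers_least:
  assumes "a * M = CARD('a) - 1" "0 < l" "l < a" "u \<noteq> (u'::'a)"
  shows "\<exists>z w. z ^ a = 1 \<and> w ^ a = 1 \<and>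
    (if z * w ^ l = (1::'a) then u' else u) \<noteq> (if z = 1 then u' else u)"
proof (intro exI conjI)
  show "(1::'a) ^ a = 1" by simp
  show "(g ^ M) ^ a = 1"
    using power_residue_root[OF gen assms(1)] generator_nonzero[OF gen] by simp
  have "M > 0" using index_factors_pos[OF assms(1)] by simp
  have "\<not> a * M dvd M * l"
  proof
    assume "a * M dvd M * l"
    then have "a dvd l" using \<open>M > 0\<close> by (simp add: mult.commute)
    then show False using assms by (meson dvd_imp_le not_le)
  qed
  then have "(g ^ M) ^ l \<noteq> g ^ 0"
    unfolding generator_power_eq_iff[OF gen] power_mult[symmetric] assms(1) cong_0_iff .
  then show "(if 1 * (g ^ M) ^ l = 1 then u' else u) \<noteq> (if 1 = (1::'a) then u' else u)"
    using assms(4) by simp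
qed

text \<open>Only the multiplier of the class of \<open>1\<close> differs from the others, and each of the maps
  \<open>\<theta>\<close>, \<open>\<theta> - id\<close>, \<open>\<theta>'\<close>, \<open>\<theta>' - id\<close>, \<open>\<theta> - \<theta>'\<close> has all its multipliers in one class, hence
  permutes the classes trivially. When \<open>a\<close> divides \<open>b\<close>, the combination \<open>u - v'\<close> does not occur.\<close>

lemma has_orthogonal_pair_two_multipliers:
  fixes u u' v v' :: 'a
  assumes c: "c * M = CARD('a) - 1" "a * a' = c" "b * b' = c" and ab: "1 < a" "1 < b"
    and ne: "u \<noteq> u'" "v \<noteq> v'" "u \<noteq> 0" "u \<noteq> 1" "v \<noteq> 0" "v \<noteq> 1" "u \<noteq> v"
    and u: "u' ^ (a' * M) = u ^ (a' * M)" "(u' - 1) ^ (a' * M) = (u - 1) ^ (a' * M)"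
    and v: "v' ^ (b' * M) = v ^ (b' * M)" "(v' - 1) ^ (b' * M) = (v - 1) ^ (b' * M)"
    and uv: "(u' - v') ^ M = (u - v) ^ M"
    and u'v: "a \<noteq> b \<Longrightarrow> (u' - v) ^ M = (u - v) ^ M"
    and uv': "\<not> a dvd b \<Longrightarrow> (u - v') ^ M = (u - v) ^ M"
  shows "has_orthogonal_pair g a b"
proof -
  have "c > 0" "M > 0" using index_factors_pos[OF c(1)] by auto
  then have "a' > 0" "b' > 0" using c by (auto intro: gr0I)
  have aM: "a * (a' * M) = CARD('a) - 1" "b * (b' * M) = CARD('a) - 1"
    using c by (simp_all flip: mult.assoc)
  let ?F = "\<lambda>z::'a. if z = 1 then u' else u" and ?G = "\<lambda>z::'a. if z = 1 then v' else v"
  \<comment> \<open>If a divides b, then b' divides a'. So wherever the second map uses v', the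
    first one uses u', and u never meets v'.\<close>
  have dvd_imp: "z ^ a' = 1" if "a dvd b" "z ^ b' = 1" for z :: 'a
  proof -
    obtain t where "b = a * t" using \<open>a dvd b\<close> by (rule dvdE)
    then have "a' = b' * t" using c ab by (metis mult.assoc mult.commute mult_cancel_left not_one_less_zero)
    then show ?thesis using that by (simp add: power_mult)
  qed
  show ?thesis
  proof (rule has_orthogonal_pairI[OF gen c, where F = ?F and G = ?G])
    show "admissible a (a' * M) ?F"
      by (rule admissible_if_power_const[where D = "u ^ (a' * M)"]) (use ne u \<open>a' > 0\<close> \<open>M > 0\<close> in auto)
    show "admissible a (a' * M) (\<lambda>z. ?F z - 1)"
      by (rule admissible_if_power_const[where D = "(u - 1) ^ (a' * M)"]) (use ne u \<open>a' > 0\<close> \<open>M > 0\<close> in auto)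
    show "admissible b (b' * M) ?G"
      by (rule admissible_if_power_const[where D = "v ^ (b' * M)"]) (use ne v \<open>b' > 0\<close> \<open>M > 0\<close> in auto)
    show "admissible b (b' * M) (\<lambda>z. ?G z - 1)"
      by (rule admissible_if_power_const[where D = "(v - 1) ^ (b' * M)"]) (use ne v \<open>b' > 0\<close> \<open>M > 0\<close> in auto)
    show "admissible c M (\<lambda>z. ?F (z ^ a') - ?G (z ^ b'))"
    proof (rule admissible_if_power_const[where D = "(u - v) ^ M"])
      fix z :: 'a
      have "a' = b'" if "a = b" using that c ab by auto
      then show "(?F (z ^ a') - ?G (z ^ b')) ^ M = (u - v) ^ M"
        using dvd_imp[of z] uv u'v uv' by auto
    qed (use ne \<open>M > 0\<close> in auto)
  qed (use two_multipliers_least[OF aM(1)] two_multipliers_least[OF aM(2)] ne in blast)+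
qed

section \<open>Large fields\<close>

lemma power_residue_mem:
  assumes "k * M = CARD('a) - 1" "x \<noteq> 0"
  shows "x ^ M \<in> {z::'a. z ^ k = 1}"
  using power_residue_root[OF gen assms] by simp

text \<open>With second multipliers \<open>1/u\<close> and \<open>1/w\<close>, all five ratios are expressed by the ratios of \<open>u\<close>, \<open>u - 1\<close>,
  \<open>u + 1\<close> to \<open>w\<close>, \<open>w - 1\<close>, \<open>w + 1\<close>, so only three residue conditions remain.\<close>

lemma has_orthogonal_pair_diagonal:
  assumes kM: "k * M = CARD('a) - 1" and k: "1 < k" and large: "k ^ 3 + 3 < CARD('a)"
  shows "has_orthogonal_pair g k k"
proof -
  have "M > 0" using index_factors_pos[OF kM] by simp
  \<comment> \<open>At most k^3 triples of residues face at least q - 3 elements. Leaving out -1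
    keeps u + 1 nonzero, which also separates u from 1 / u.\<close>
  let ?R = "{z::'a. z ^ k = 1}" and ?S = "UNIV - {0, 1, -1::'a}"
  let ?f = "\<lambda>u::'a. (u ^ M, (u - 1) ^ M, (u + 1) ^ M)"
  have R: "card ?R \<le> k" using card_roots_of_unity_le[where 'a = 'a] k by simp
  have "?f ` ?S \<subseteq> ?R \<times> ?R \<times> ?R"
  proof (rule image_subsetI)
    fix u assume "u \<in> ?S"
    then have "u \<noteq> 0" "u - 1 \<noteq> 0" "u + 1 \<noteq> 0" by (auto simp: add_eq_0_iff2)
    then show "?f u \<in> ?R \<times> ?R \<times> ?R" using power_residue_mem[OF kM] by blast
  qed
  then have "card (?f ` ?S) \<le> card (?R \<times> ?R \<times> ?R)" by (intro card_mono) auto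
  also have "\<dots> \<le> k * (k * k)" unfolding card_cartesian_product by (intro mult_le_mono R)
  also have "\<dots> = k ^ 3" by (simp add: power3_eq_cube)
  also have "\<dots> < CARD('a) - card {0, 1, -1::'a}"
    using large card_length[of "[0, 1, -1::'a]"] by simp
  also have "\<dots> \<le> card ?S" by (rule diff_card_le_card_Diff) simp
  finally have "\<not> inj_on ?f ?S" by (rule pigeonhole)
  then obtain u w where uw: "u \<in> ?S" "w \<in> ?S" "u \<noteq> w" "?f u = ?f w"
    unfolding inj_on_def by blast
  have nz: "u \<noteq> 0" "w \<noteq> 0" using uw by auto
  have pm: "(w - 1 / w) ^ M = (u - 1 / u) ^ M" "(1 / w - 1) ^ M = (1 / u - 1) ^ M"
  proof -
    have inv: "x - 1 / x = (x - 1) * (x + 1) / x" "1 / x - 1 = - 1 * (x - 1) / x" if "x \<noteq> 0" for x :: 'a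
      using that by (simp_all add: field_simps)
    have eq: "w ^ M = u ^ M" "(w - 1) ^ M = (u - 1) ^ M" "(w + 1) ^ M = (u + 1) ^ M"
      using uw(4) by simp_all
    show "(w - 1 / w) ^ M = (u - 1 / u) ^ M"
      unfolding inv(1)[OF nz(1)] inv(1)[OF nz(2)] power_mult_distrib power_divide eq ..
    show "(1 / w - 1) ^ M = (1 / u - 1) ^ M"
      unfolding inv(2)[OF nz(1)] inv(2)[OF nz(2)] power_mult_distrib power_divide eq ..
  qed
  have "u \<noteq> 1 / u"
  proof
    assume "u = 1 / u"
    then have "(u - 1) * (u + 1) = 0" using nz by (simp add: field_simps)
    then show False using uw(1) by (auto simp: add_eq_0_iff2)
  qed
  then show ?thesis
    using uw nz pm kM k
    by (intro has_orthogonal_pair_two_multipliers[where c = k and M = M and a' = 1 and b' = 1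
          and u = u and u' = w and v = "1 / u" and v' = "1 / w"])
       (auto simp: power_divide field_simps)
qed

text \<open>The ratio t = (u - v) / (u - v') determines u through \<open>?f\<close>, and its M-th
  power must be 1. Each M-th root of unity other than 1 gives a solution; t = 1 would put u at
  infinity.\<close>

lemma card_equal_residues:
  assumes cM: "c * M = CARD('a) - 1" and "v \<noteq> v'"
  shows "M - 1 \<le> card {u::'a. u \<noteq> v \<and> u \<noteq> v' \<and> (u - v) ^ M = (u - v') ^ M}" (is "_ \<le> card ?U")
proof -
  let ?f = "\<lambda>t. (v - t * v') / (1 - t)"
  let ?T = "{t::'a. t ^ M = 1} - {1}"
  have "M > 0" using index_factors_pos[OF cM] by simp
  have diffs: "?f t - v = t * (v - v') / (1 - t)" "?f t - v' = (v - v') / (1 - t)" if "t \<noteq> 1" for t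
    using that by (simp_all add: field_simps)
  have sub: "?f ` ?T \<subseteq> ?U"
  proof (rule image_subsetI)
    fix t assume t: "t \<in> ?T"
    then have "t \<noteq> 0" using \<open>M > 0\<close> by (auto simp: power_0_left)
    have "?f t - v \<noteq> 0" "?f t - v' \<noteq> 0"
      using t \<open>v \<noteq> v'\<close> \<open>t \<noteq> 0\<close> by (simp_all add: diffs)
    moreover have "(?f t - v) ^ M = (?f t - v') ^ M"
      using t by (simp add: diffs power_divide power_mult_distrib)
    ultimately show "?f t \<in> ?U" by auto
  qed
  have "inj_on ?f ?T"
  proof (rule inj_onI)
    fix s t assume st: "s \<in> ?T" "t \<in> ?T" "?f s = ?f t"
    then have "(v - v') / (1 - s) = (v - v') / (1 - t)"
      using diffs(2)[of s] diffs(2)[of t] by (metis DiffD2 singletonI)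
    then show "s = t" unfolding divide_cancel_left using \<open>v \<noteq> v'\<close> by simp
  qed
  then have "card ?T \<le> card ?U" using sub by (intro card_inj_on_le) auto
  moreover have "card ?T = M - 1"
    using card_power_residues[OF gen cM] by (simp add: card_Diff_singleton)
  ultimately show ?thesis by simp
qed

text \<open>When a and b differ, u' - v occurs as well, and so may u - v'; with inverses as second
  multipliers these are not controlled by the residues of u, u - 1 and u + 1. Choosing u and u' with
  all four of u - v, u - v', u' - v, u' - v' in one class settles every case.\<close>

lemma has_orthogonal_pair_offdiagonal:
  assumes c: "c * M = CARD('a) - 1" "a * a' = c" "b * b' = c" and ab: "1 < a" "1 < b"
    and large: "b ^ 2 + 2 < CARD('a)" "c * a ^ 2 + 3 < M"
  shows "has_orthogonal_pair g a b"
proof -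
  have aM: "a * (a' * M) = CARD('a) - 1" "b * (b' * M) = CARD('a) - 1"
    using c by (simp_all flip: mult.assoc)
  have "c > 0" using index_factors_pos[OF c(1)] by simp
  let ?R = "\<lambda>k. {z::'a. z ^ k = 1}"
  have R: "k > 0 \<Longrightarrow> card (?R k) \<le> k" for k using card_roots_of_unity_le[where 'a = 'a] by simp
  obtain v v' :: 'a where v: "v \<noteq> 0" "v \<noteq> 1" "v \<noteq> v'"
    "v' ^ (b' * M) = v ^ (b' * M)" "(v' - 1) ^ (b' * M) = (v - 1) ^ (b' * M)"
  proof -
    let ?S = "UNIV - {0, 1::'a}" and ?f = "\<lambda>v::'a. (v ^ (b' * M), (v - 1) ^ (b' * M))"
    have "?f ` ?S \<subseteq> ?R b \<times> ?R b"
      using power_residue_mem[OF aM(2)] by auto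
    then have "card (?f ` ?S) \<le> card (?R b \<times> ?R b)" by (intro card_mono) auto
    also have "\<dots> \<le> b * b" unfolding card_cartesian_product using ab by (intro mult_le_mono R) auto
    also have "\<dots> < card ?S" using large(1) by (simp add: card_Diff_subset power2_eq_square)
    finally have "\<not> inj_on ?f ?S" by (rule pigeonhole)
    then show ?thesis using that unfolding inj_on_def by (metis Diff_iff Pair_inject insertCI)
  qed
  let ?U = "{u::'a. u \<noteq> v \<and> u \<noteq> v' \<and> (u - v) ^ M = (u - v') ^ M}"
  let ?S = "?U - {0, 1::'a}" and ?f = "\<lambda>u::'a. ((u - v) ^ M, u ^ (a' * M), (u - 1) ^ (a' * M))"
  have "?f ` ?S \<subseteq> ?R c \<times> ?R a \<times> ?R a"
    using power_residue_mem[OF c(1)] power_residue_mem[OF aM(1)] by auto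
  then have "card (?f ` ?S) \<le> card (?R c \<times> ?R a \<times> ?R a)" by (intro card_mono) auto
  also have "\<dots> \<le> c * (a * a)"
    unfolding card_cartesian_product using ab \<open>c > 0\<close> by (intro mult_le_mono R) auto
  \<comment> \<open>\<open>card_equal_residues\<close> provides M - 1 elements, of which 0 and 1 are
    excluded; hence the summand 3 in the bound on M.\<close>
  also have "\<dots> < (M - 1) - 2" using large(2) by (simp add: power2_eq_square)
  also have "\<dots> \<le> card ?U - card {0, 1::'a}"
    using card_equal_residues[OF c(1) v(3)] by simp
  also have "\<dots> \<le> card ?S" by (rule diff_card_le_card_Diff) simp
  finally have "\<not> inj_on ?f ?S" by (rule pigeonhole)
  then obtain u u' where u: "u \<in> ?S" "u' \<in> ?S" "u \<noteq> u'" "?f u = ?f u'"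
    unfolding inj_on_def by blast
  then show ?thesis
    using v by (intro has_orthogonal_pair_two_multipliers[OF c ab, where u = u and u' = u' and v = v and v' = v']) auto
qed

section \<open>Frobenius twists\<close>

text \<open>An exponent congruent to 1 mod k keeps an element in its class of index k. A power of
  the Frobenius map with such an exponent does so and also commutes with subtraction.\<close>

lemma power_Suc_mult_residue:
  assumes "k * M = CARD('a) - 1"
  shows "(x ^ (k * n + 1)) ^ M = (x::'a) ^ M"
proof (cases "x = 0")
  case False
  then have "x ^ (k * M * n) = 1" using nonzero_power_card[OF False] by (simp only: assms power_mult power_one)
  then show ?thesis by (simp add: algebra_simps power_add flip: power_mult)
qed (cases M; simp)

text \<open>The elements of the subfield of order 4 have distinct fifth powers, so two multipliers
  taken from it never share a class. Instead u' and v' are the images of u = g and v = g^2 under x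
  -> x^4. This map is additive and 4 is 1 mod 3, so u - 1, v - 1 and u - v are carried to elements
  of their own classes.\<close>

lemma has_orthogonal_pair_16:
  assumes card: "CARD('a) = 16"
  shows "has_orthogonal_pair g 3 3"
proof -
  have "CHAR('a) dvd 2 ^ 4" using CHAR_dvd_CARD[where 'a = 'a] card by simp
  moreover have pr: "prime CHAR('a)" by (simp add: finite_imp_CHAR_pos prime_CHAR_semidom)
  ultimately have ch: "CHAR('a) = 2" by (metis prime_dvd_power primes_dvd_imp_eq two_is_prime_nat)
  have "(x - y + y) ^ 4 = (x - y) ^ 4 + y ^ 4" for x y :: 'a
    by (rule freshmans_dream'[where n = 2]) (simp_all add: ch)
  then have frob: "x ^ 4 - y ^ 4 = (x - y) ^ 4" for x y :: 'a
    by (metis add_diff_cancel_right' diff_add_cancel)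
  have k: "3 * 5 = CARD('a) - 1" using card by simp
  have res: "(x ^ 4) ^ 5 = x ^ 5" for x :: 'a using power_Suc_mult_residue[OF k, of x 1] by simp
  have g: "g ^ i = g ^ j \<longleftrightarrow> i = j" if "i < 15" "j < 15" for i j
    using generator_power_eq_iff[OF gen, of i j] card that by (simp add: cong_def)
  have ne: "g \<noteq> g ^ 4" "g ^ 2 \<noteq> g ^ 8" "g \<noteq> 1" "g ^ 2 \<noteq> 1" "g \<noteq> g ^ 2"
    using g[of 1 4] g[of 2 8] g[of 1 0] g[of 2 0] g[of 1 2] by simp_all
  have pw: "g ^ 8 = (g ^ 2) ^ 4" by simp
  show ?thesis
  proof (rule has_orthogonal_pair_two_multipliers[where c = 3 and M = 5 and a' = 1 and b' = 1
        and u = g and u' = "g ^ 4" and v = "g ^ 2" and v' = "g ^ 8"])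
    show "(g ^ 4 - 1) ^ (1 * 5) = (g - 1) ^ (1 * 5)" using res[of "g - 1"] frob[of g 1] by simp
    show "(g ^ 8 - 1) ^ (1 * 5) = (g ^ 2 - 1) ^ (1 * 5)" using res[of "g ^ 2 - 1"] frob[of "g ^ 2" 1] by simp
    show "(g ^ 4 - g ^ 8) ^ 5 = (g - g ^ 2) ^ 5" using res[of "g - g ^ 2"] frob[of g "g ^ 2"] by simp
    show "(g ^ 4) ^ (1 * 5) = g ^ (1 * 5)" using res[of g] by simp
    show "(g ^ 8) ^ (1 * 5) = (g ^ 2) ^ (1 * 5)" using res[of "g ^ 2"] by simp
  qed (use ne generator_nonzero[OF gen] k in simp_all)
qed

text \<open>Here M = 57, so \<open>c * a ^ 2 + 3 < M\<close> just fails. The map x -> x^7 fixes v =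
  3 and v' = 5, and 7 is 1 mod 6; so with u' = u^7 each of u, u - 1, u - 3, u - 5 is carried to an
  element of its own class. It remains to find u outside the prime field with u - 3 and u - 5 in one
  class.\<close>

lemma has_orthogonal_pair_343:
  assumes card: "CARD('a) = 343"
  shows "has_orthogonal_pair g 3 6"
proof -
  have "CHAR('a) dvd 7 ^ 3" using CHAR_dvd_CARD[where 'a = 'a] card by simp
  moreover have pr: "prime CHAR('a)" by (simp add: finite_imp_CHAR_pos prime_CHAR_semidom)
  moreover have "prime (7::nat)" by simp
  ultimately have ch: "CHAR('a) = 7" by (metis prime_dvd_power primes_dvd_imp_eq)
  have eq7: "of_nat m = (of_nat n :: 'a) \<longleftrightarrow> [m = n] (mod 7)" for m n
    by (simp add: of_nat_eq_iff_cong_CHAR ch)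
  have "(x - y + y) ^ 7 = (x - y) ^ 7 + y ^ 7" for x y :: 'a
    by (rule freshmans_dream) (simp_all add: ch)
  then have frob: "x ^ 7 - y ^ 7 = (x - y) ^ 7" for x y :: 'a
    by (metis add_diff_cancel_right' diff_add_cancel)
  have k: "6 * 57 = CARD('a) - 1" using card by simp
  have res: "(x ^ 7) ^ 57 = x ^ 57" for x :: 'a using power_Suc_mult_residue[OF k, of x 1] by simp
  let ?U = "{u::'a. u \<noteq> 3 \<and> u \<noteq> 5 \<and> (u - 3) ^ 57 = (u - 5) ^ 57}"
  have n7: "(3::'a) ^ 7 = 3" "(5::'a) ^ 7 = 5" "(8::'a) = 1" "(10::'a) = 3" "3 \<noteq> (5::'a)" "(4::'a) \<noteq> 0"
    "(3::'a) \<noteq> 0" "(3::'a) \<noteq> 1" "(5::'a) \<noteq> 0" "(5::'a) \<noteq> 1" "(2::'a) \<noteq> 0"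
    using eq7[of "3 ^ 7" 3] eq7[of "5 ^ 7" 5] eq7[of 8 1] eq7[of 10 3] eq7[of 3 5] eq7[of 4 0]
      eq7[of 3 0] eq7[of 3 1] eq7[of 5 0] eq7[of 5 1] eq7[of 2 0]
    by (simp_all add: cong_def)
  \<comment> \<open>2 has order 3, which divides 57. Modulo 7, 3 = 5 * 2 and 5 - 1 = 2 * (3 - 1), so
    both residue conditions on v = 3 and v' = 5 reduce to this.\<close>
  have two: "(2::'a) ^ 57 = 1"
  proof -
    have "(2::'a) ^ 57 = (2 ^ 3) ^ 19" by (simp only: flip: power_mult) simp
    then show ?thesis using n7 by simp
  qed
  \<comment> \<open>Only the prime field is fixed by x -> x^7, too few elements to exhaust the 56 or
    more in \<open>?U\<close>.\<close>
  have "card {u::'a. u ^ 7 = u} \<le> 7"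
  proof -
    have "{u::'a. u ^ 7 = u} \<subseteq> insert 0 {u. u ^ 6 = 1}"
    proof (intro subsetI CollectI insertCI)
      fix u :: 'a assume u: "u \<in> {u. u ^ 7 = u}" "u \<notin> {u. u ^ 6 = 1}"
      then have "u * (u ^ 6 - 1) = 0" by (simp add: algebra_simps power_numeral_reduce)
      then show "u = 0" using u by auto
    qed
    then have "card {u::'a. u ^ 7 = u} \<le> card (insert 0 {u::'a. u ^ 6 = 1})" by (intro card_mono) auto
    also have "\<dots> \<le> Suc 6"
      using card_roots_of_unity_le[where 'a = 'a, of 6] by (intro card_insert_le_m1) auto
    finally show ?thesis by simp
  qed
  moreover have "card ?U \<ge> 56"
    using card_equal_residues[OF k, of 3 5] n7 by simp
  ultimately have "\<not> ?U \<subseteq> {u. u ^ 7 = u}" using card_mono[of "{u::'a. u ^ 7 = u}" ?U] by auto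
  then obtain u where u: "u \<in> ?U" "u \<noteq> u ^ 7" by fastforce
  show ?thesis
  proof (rule has_orthogonal_pair_two_multipliers[where c = 6 and M = 57 and a' = 2 and b' = 1
        and u = u and u' = "u ^ 7" and v = 3 and v' = 5])
    have r2: "(x ^ 7) ^ (2 * 57) = x ^ (2 * 57)" for x :: 'a
    proof -
      have "(x ^ 7) ^ (2 * 57) = ((x ^ 7) ^ 57) ^ 2" by (simp only: mult.commute[of 2] power_mult)
      also have "\<dots> = x ^ (2 * 57)" unfolding res by (simp only: mult.commute[of 2] power_mult)
      finally show ?thesis .
    qed
    show "(u ^ 7) ^ (2 * 57) = u ^ (2 * 57)" by (rule r2)
    show "(u ^ 7 - 1) ^ (2 * 57) = (u - 1) ^ (2 * 57)" using r2[of "u - 1"] frob[of u 1] by simp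
    have "(5::'a) ^ 57 = 5 ^ 57 * 2 ^ 57" using two by simp
    also have "\<dots> = (5 * 2) ^ 57" by (rule power_mult_distrib [symmetric])
    also have "\<dots> = 3 ^ 57" using n7 by simp
    finally show "(5::'a) ^ (1 * 57) = 3 ^ (1 * 57)" by simp
    have "(5 - 1 :: 'a) = 2 * 2" "(3 - 1 :: 'a) = 2" by simp_all
    then show "(5 - 1 :: 'a) ^ (1 * 57) = (3 - 1) ^ (1 * 57)"
      by (simp only: power_mult_distrib mult_1 two)
    show "(u ^ 7 - 5) ^ 57 = (u - 3) ^ 57" using res[of "u - 5"] frob[of u 5] n7 u by simp
    show "(u ^ 7 - 3) ^ 57 = (u - 3) ^ 57" using res[of "u - 3"] frob[of u 3] n7 by simp
    show "u \<noteq> 0"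
    proof
      assume "u = 0" then show False using u(2) by simp
    qed
    show "u \<noteq> 1"
    proof
      assume "u = 1" then show False using u(2) by simp
    qed
  qed (use u n7 k in auto)
qed

end

section \<open>Pairs given by lists of multipliers\<close>

text \<open>Entry i is the M-th power of the image of any x with x^M = \<zeta>^i, so it names the
  class to which the class of x is sent. Distinct weights mean that the classes are
  permuted.\<close>

definition weights :: "nat \<Rightarrow> 'a::field \<Rightarrow> 'a list \<Rightarrow> 'a list" where
  "weights M \<zeta> ms = map (\<lambda>i. \<zeta> ^ i * (ms ! i) ^ M) [0..<length ms]"

definition multipliers_ok :: "nat \<Rightarrow> 'a::field \<Rightarrow> 'a list \<Rightarrow> bool" where
  "multipliers_ok M \<zeta> ms \<longleftrightarrow> 0 \<notin> set ms \<and> distinct (weights M \<zeta> ms)"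

text \<open>The least discrete logarithm to base \<zeta> turns a list into a function on roots of
  unity.\<close>

definition lookup_power :: "'a::field \<Rightarrow> 'a list \<Rightarrow> 'a \<Rightarrow> 'a" where
  "lookup_power \<zeta> ms z = ms ! (LEAST i. \<zeta> ^ i = z)"

lemma power_mod_root_of_unity:
  fixes \<zeta> :: "'a::field"
  assumes "\<zeta> ^ k = 1"
  shows "\<zeta> ^ (i mod k) = \<zeta> ^ i"
proof -
  have "\<zeta> ^ i = (\<zeta> ^ k) ^ (i div k) * \<zeta> ^ (i mod k)"
    by (simp flip: power_mult power_add)
  then show ?thesis using assms by simp
qed

lemma lookup_power_eq:
  assumes "\<zeta> ^ k = 1" "inj_on (\<lambda>i. \<zeta> ^ i) {..<k}" "k > 0"
  shows "lookup_power \<zeta> ms (\<zeta> ^ i) = ms ! (i mod k)"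
proof -
  have "(LEAST j. \<zeta> ^ j = \<zeta> ^ i) = i mod k"
  proof (rule Least_equality)
    show "\<zeta> ^ (i mod k) = \<zeta> ^ i" by (rule power_mod_root_of_unity) fact
    fix j assume j: "\<zeta> ^ j = \<zeta> ^ i"
    then have "\<zeta> ^ (j mod k) = \<zeta> ^ (i mod k)" using assms(1) by (simp add: power_mod_root_of_unity)
    then have "j mod k = i mod k" using assms by (auto dest: inj_onD)
    then show "i mod k \<le> j" by (metis mod_less_eq_dividend)
  qed
  then show ?thesis by (simp add: lookup_power_def)
qed

lemma roots_of_unity_eq_powers:
  fixes \<zeta> :: "'a::{field,finite}"
  assumes "\<zeta> ^ k = 1" "inj_on (\<lambda>i. \<zeta> ^ i) {..<k}" "k > 0"
  shows "{z. z ^ k = 1} = (\<lambda>i. \<zeta> ^ i) ` {..<k}"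
proof (rule sym, rule card_seteq)
  show "(\<lambda>i. \<zeta> ^ i) ` {..<k} \<subseteq> {z. z ^ k = 1}"
    using assms(1) by (auto simp: mult.commute[of _ k] power_mult simp flip: power_mult)
      (metis mult.commute power_mult power_one)
  show "card {z::'a. z ^ k = 1} \<le> card ((\<lambda>i. \<zeta> ^ i) ` {..<k})"
    using card_roots_of_unity_le[where 'a = 'a, OF assms(3)] assms(2) by (simp add: card_image)
qed simp

lemma admissible_list:
  fixes H :: "'a::{field,finite} \<Rightarrow> 'a"
  assumes \<zeta>: "\<zeta> ^ k = 1" "inj_on (\<lambda>i. \<zeta> ^ i) {..<k}" "k > 0"
    and ms: "length ms = k" "multipliers_ok M \<zeta> ms" "\<And>i. i < k \<Longrightarrow> H (\<zeta> ^ i) = ms ! i"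
  shows "admissible k M H"
  unfolding admissible_def roots_of_unity_eq_powers[OF \<zeta>]
proof (intro conjI allI impI inj_onI)
  fix z :: 'a assume "z ^ k = 1"
  then obtain i where "i < k" "z = \<zeta> ^ i" using roots_of_unity_eq_powers[OF \<zeta>] by auto
  then show "H z \<noteq> 0" using ms by (metis multipliers_ok_def nth_mem)
next
  fix z w assume "z \<in> (\<lambda>i. \<zeta> ^ i) ` {..<k}" "w \<in> (\<lambda>i. \<zeta> ^ i) ` {..<k}"
    and eq: "z * H z ^ M = w * H w ^ M"
  then obtain i j where ij: "i < k" "z = \<zeta> ^ i" "j < k" "w = \<zeta> ^ j" by auto
  have "distinct (map (\<lambda>i. \<zeta> ^ i * (ms ! i) ^ M) [0..<k])"
    using ms by (simp add: multipliers_ok_def weights_def)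
  then have "inj_on (\<lambda>i. \<zeta> ^ i * (ms ! i) ^ M) {0..<k}" by (simp add: distinct_map)
  then have "i = j" using eq ij ms(3) by (auto dest!: inj_onD)
  then show "z = w" using ij by simp
qed

lemma nth_concat_replicate:
  assumes "i < n * length xs"
  shows "concat (replicate n xs) ! i = xs ! (i mod length xs)"
  using assms
proof (induction n arbitrary: i)
  case (Suc n)
  show ?case
  proof (cases "i < length xs")
    case False
    then have "i - length xs < n * length xs" using Suc.prems by auto
    then show ?thesis using False Suc.IH[of "i - length xs"] by (simp add: nth_append le_mod_geq)
  qed (simp add: nth_append)
qed simp

lemma length_concat_replicate: "length (concat (replicate n xs)) = n * length xs"
  by (induction n) auto

text \<open>Having a multiplier of the class of \<open>1\<close> that occurs only once makes the index least.\<close>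

lemma has_orthogonal_pair_lists:
  fixes g \<zeta> :: "'a::{field,finite}"
  assumes gen: "field_generator g"
    and c: "c * M = CARD('a) - 1" "a * a' = c" "b * b' = c"
    and len: "length us = a" "length vs = b"
    and \<zeta>: "\<zeta> ^ c = 1" "inj_on (\<lambda>i. \<zeta> ^ i) {..<c}"
    and us: "multipliers_ok (a' * M) (\<zeta> ^ a') us" "multipliers_ok (a' * M) (\<zeta> ^ a') (map (\<lambda>u. u - 1) us)"
    and vs: "multipliers_ok (b' * M) (\<zeta> ^ b') vs" "multipliers_ok (b' * M) (\<zeta> ^ b') (map (\<lambda>v. v - 1) vs)"
    and uv: "multipliers_ok M \<zeta> (map2 (-) (concat (replicate a' us)) (concat (replicate b' vs)))"
    and least: "hd us \<notin> set (tl us)" "hd vs \<notin> set (tl vs)"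
  shows "has_orthogonal_pair g a b"
proof -
  have pos: "c > 0" "M > 0" using index_factors_pos[OF c(1)] by auto
  have root: "(\<zeta> ^ n) ^ k = 1" "inj_on (\<lambda>i. (\<zeta> ^ n) ^ i) {..<k}" "k > 0" "n > 0" if "k * n = c" for k n
  proof -
    show "k > 0" "n > 0" using that pos by (auto intro: gr0I)
    show "(\<zeta> ^ n) ^ k = 1" using \<zeta> that by (metis mult.commute power_mult)
    show "inj_on (\<lambda>i. (\<zeta> ^ n) ^ i) {..<k}"
    proof (rule inj_onI)
      fix i j assume ij: "i \<in> {..<k}" "j \<in> {..<k}" "(\<zeta> ^ n) ^ i = (\<zeta> ^ n) ^ j"
      then have "n * i < c" "n * j < c" using that \<open>n > 0\<close> by (auto simp: mult.commute)
      then show "i = j" using ij \<zeta>(2) \<open>n > 0\<close> by (auto dest!: inj_onD simp flip: power_mult)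
    qed
  qed
  let ?F = "lookup_power (\<zeta> ^ a') us" and ?G = "lookup_power (\<zeta> ^ b') vs"
  have look: "lookup_power (\<zeta> ^ n) ms ((\<zeta> ^ n) ^ i) = ms ! (i mod k)" if "k * n = c" for k n i ms
    by (rule lookup_power_eq[OF root(1-3)[OF that]])
  have adm: "admissible k (n * M) (lookup_power (\<zeta> ^ n) ms)"
    "admissible k (n * M) (\<lambda>z. lookup_power (\<zeta> ^ n) ms z - 1)"
    if "k * n = c" "length ms = k" "multipliers_ok (n * M) (\<zeta> ^ n) ms"
      "multipliers_ok (n * M) (\<zeta> ^ n) (map (\<lambda>v. v - 1) ms)" for k n ms
    by (rule admissible_list[OF root(1-3)[OF that(1)] that(2,3)], simp add: look[OF that(1)],
      rule admissible_list[OF root(1-3)[OF that(1)] _ that(4)], simp_all add: look[OF that(1)] that(2))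
  have least': "\<exists>z w. z ^ k = 1 \<and> w ^ k = 1 \<and> lookup_power (\<zeta> ^ n) ms (z * w ^ l) \<noteq> lookup_power (\<zeta> ^ n) ms z"
    if "k * n = c" "length ms = k" "hd ms \<notin> set (tl ms)" "0 < l" "l < k" for k n ms l
  proof (intro exI conjI)
    show "1 ^ k = (1::'a)" by simp
    show "(\<zeta> ^ n) ^ k = 1" using root[OF that(1)] by simp
    have "ms ! l \<in> set (tl ms)"
      using that by (cases ms) (auto simp: nth_Cons' intro!: nth_mem)
    moreover have "ms ! 0 = hd ms" using that by (cases ms) auto
    ultimately have "ms ! l \<noteq> ms ! 0" using that by metis
    moreover have "lookup_power (\<zeta> ^ n) ms ((\<zeta> ^ n) ^ l) = ms ! l"
      using look[OF that(1), where ms = ms and i = l] that by simp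
    moreover have "lookup_power (\<zeta> ^ n) ms 1 = ms ! 0"
      using look[OF that(1), where ms = ms and i = 0] by simp
    ultimately show "lookup_power (\<zeta> ^ n) ms (1 * (\<zeta> ^ n) ^ l) \<noteq> lookup_power (\<zeta> ^ n) ms 1" by simp
  qed
  show ?thesis
  proof (rule has_orthogonal_pairI[OF gen c, where F = ?F and G = ?G])
    show "admissible c M (\<lambda>z. ?F (z ^ a') - ?G (z ^ b'))"
    proof (rule admissible_list[OF \<zeta> pos(1) _ uv])
      show "length (map2 (-) (concat (replicate a' us)) (concat (replicate b' vs))) = c"
        using c len by (simp add: length_concat_replicate mult.commute)
      fix i assume "i < c"
      moreover have "?F ((\<zeta> ^ i) ^ a') = us ! (i mod a)" "?G ((\<zeta> ^ i) ^ b') = vs ! (i mod b)"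
        using look[OF c(2), where ms = us and i = i] look[OF c(3), where ms = vs and i = i] by (simp_all add: mult.commute flip: power_mult)
      ultimately show "?F ((\<zeta> ^ i) ^ a') - ?G ((\<zeta> ^ i) ^ b') =
          map2 (-) (concat (replicate a' us)) (concat (replicate b' vs)) ! i"
        using c len by (simp add: length_concat_replicate nth_concat_replicate mult.commute)
    qed
  qed (use adm[OF c(2) len(1) us] adm[OF c(3) len(2) vs] least'[OF c(2) len(1) least(1)]
      least'[OF c(3) len(2) least(2)] in blast)+
qed

section \<open>Computing in quadratic extensions of prime fields\<close>

text \<open>The pair \<open>(x, y)\<close> stands for \<open>x + y \<alpha>\<close>, where \<open>\<alpha>\<^sup>2 = d + e \<alpha>\<close>; in prime fields, \<open>\<alpha> = d = e = 0\<close>.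
  Squaring is a separate function so that the simplifier does not evaluate its argument twice, and
  recursions replace higher-order list functions because it would unfold abstractions symbolically.\<close>

fun ext_mult :: "int \<Rightarrow> int \<Rightarrow> int \<Rightarrow> int \<times> int \<Rightarrow> int \<times> int \<Rightarrow> int \<times> int" where
  "ext_mult p d e (x, y) (x', y') =
     ((x * x' + d * (y * y')) mod p, (x * y' + y * x' + e * (y * y')) mod p)"

fun ext_square :: "int \<Rightarrow> int \<Rightarrow> int \<Rightarrow> int \<times> int \<Rightarrow> int \<times> int" where
  "ext_square p d e (x, y) = ((x * x + d * (y * y)) mod p, (2 * (x * y) + e * (y * y)) mod p)"

fun ext_minus :: "int \<Rightarrow> int \<times> int \<Rightarrow> int \<times> int \<Rightarrow> int \<times> int" where
  "ext_minus p (x, y) (x', y') = ((x - x') mod p, (y - y') mod p)"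

text \<open>Exponents up to 1 all return the base, so that exponent 0 gives v and not 1. This is why
  \<open>ext_value_power\<close> starts at exponent 1.\<close>

function ext_power :: "int \<Rightarrow> int \<Rightarrow> int \<Rightarrow> int \<times> int \<Rightarrow> int \<Rightarrow> int \<times> int" where
  "ext_power p d e v n =
     (if n \<le> 1 then v
      else if n mod 2 = 0 then ext_square p d e (ext_power p d e v (n div 2))
      else ext_mult p d e v (ext_square p d e (ext_power p d e v (n div 2))))"
  by auto
termination by (relation "Wellfounded.measure (\<lambda>(p, d, e, v, n). nat n)") auto

declare ext_power.simps [simp del]

text \<open>Not assumed injective: distinct pairs may have the same value, for instance when
  \<alpha> = 0. Computed equalities transfer to the field; inequalities go through
  \<open>ext_nonzero\<close>.\<close>

definition ext_value :: "'a::field \<Rightarrow> int \<times> int \<Rightarrow> 'a" where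
  "ext_value \<alpha> v = of_int (fst v) + of_int (snd v) * \<alpha>"

fun ext_prod :: "int \<Rightarrow> int \<Rightarrow> int \<Rightarrow> (int \<times> int) list \<Rightarrow> int \<times> int" where
  "ext_prod p d e [] = (1, 0)"
| "ext_prod p d e (v # vs) = ext_mult p d e v (ext_prod p d e vs)"

fun ext_minus_list :: "int \<Rightarrow> int \<times> int \<Rightarrow> (int \<times> int) list \<Rightarrow> (int \<times> int) list" where
  "ext_minus_list p v [] = []"
| "ext_minus_list p v (w # ws) = ext_minus p w v # ext_minus_list p v ws"

fun ext_minus_lists :: "int \<Rightarrow> (int \<times> int) list \<Rightarrow> (int \<times> int) list \<Rightarrow> (int \<times> int) list" where
  "ext_minus_lists p (v # vs) (w # ws) = ext_minus p v w # ext_minus_lists p vs ws"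
| "ext_minus_lists p vs ws = []"

fun ext_differences :: "int \<Rightarrow> (int \<times> int) list \<Rightarrow> (int \<times> int) list" where
  "ext_differences p [] = []"
| "ext_differences p (v # vs) = ext_minus_list p v vs @ ext_differences p vs"

fun ext_weights :: "int \<Rightarrow> int \<Rightarrow> int \<Rightarrow> int \<Rightarrow> int \<times> int \<Rightarrow> int \<times> int \<Rightarrow> (int \<times> int) list \<Rightarrow> (int \<times> int) list" where
  "ext_weights p d e M z \<zeta> [] = []"
| "ext_weights p d e M z \<zeta> (m # ms) =
     ext_mult p d e z (ext_power p d e m M) # ext_weights p d e M (ext_mult p d e z \<zeta>) \<zeta> ms"

text \<open>These are the elements whose nonvanishing amounts to
  \<open>multipliers_ok\<close>.\<close>

definition ext_multipliers :: "int \<Rightarrow> int \<Rightarrow> int \<Rightarrow> int \<Rightarrow> int \<times> int \<Rightarrow> (int \<times> int) list \<Rightarrow> (int \<times> int) list" where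
  "ext_multipliers p d e M \<zeta> ms = ms @ ext_differences p (ext_weights p d e M (1, 0) \<zeta> ms)"

text \<open>Nonzero elements have (q-1)-th power 1 and zero does not, so one power of the product
  certifies that no factor vanishes.\<close>

definition ext_nonzero :: "int \<Rightarrow> int \<Rightarrow> int \<Rightarrow> int \<Rightarrow> (int \<times> int) list \<Rightarrow> bool" where
  "ext_nonzero p d e q vs \<longleftrightarrow> ext_power p d e (ext_prod p d e vs) (q - 1) = (1, 0)"

text \<open>All inequalities that are required enter one long product, which is tested once. The
  weights of the constant list of ones with exponent 1 are 1, \<zeta>, \<zeta>^2 and so on; their
  differences show that \<zeta> has the full order (q - 1) div M.\<close>

fun ext_list_check :: "int \<Rightarrow> int \<Rightarrow> int \<Rightarrow> int \<Rightarrow> nat \<Rightarrow> nat \<Rightarrow> int \<Rightarrow> int \<times> int \<Rightarrow>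
    (int \<times> int) list \<Rightarrow> (int \<times> int) list \<Rightarrow> bool" where
  "ext_list_check p d e q a' b' M \<zeta> us vs =
    (ext_power p d e \<zeta> ((q - 1) div M) = (1, 0) \<and>
     ext_nonzero p d e q
      (ext_differences p (ext_weights p d e 1 (1, 0) \<zeta> (replicate (nat ((q - 1) div M)) (1, 0))) @
       ext_multipliers p d e (int a' * M) (ext_power p d e \<zeta> (int a')) us @
       ext_multipliers p d e (int a' * M) (ext_power p d e \<zeta> (int a')) (ext_minus_list p (1, 0) us) @
       ext_multipliers p d e (int b' * M) (ext_power p d e \<zeta> (int b')) vs @
       ext_multipliers p d e (int b' * M) (ext_power p d e \<zeta> (int b')) (ext_minus_list p (1, 0) vs) @
       ext_multipliers p d e M \<zeta>
         (ext_minus_lists p (concat (replicate a' us)) (concat (replicate b' vs))) @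
       ext_minus_list p (hd us) (tl us) @ ext_minus_list p (hd vs) (tl vs)))"

fun ext_pair_check :: "int \<Rightarrow> int \<Rightarrow> int \<Rightarrow> int \<Rightarrow> nat \<Rightarrow> nat \<Rightarrow> nat \<Rightarrow> nat \<Rightarrow> int \<Rightarrow>
    int \<times> int \<Rightarrow> int \<times> int \<Rightarrow> int \<times> int \<Rightarrow> int \<times> int \<Rightarrow> bool" where
  "ext_pair_check p d e q a b a' b' M u u' v v' =
    (ext_power p d e u' (int a' * M) = ext_power p d e u (int a' * M) \<and>
     ext_power p d e (ext_minus p u' (1, 0)) (int a' * M) =
       ext_power p d e (ext_minus p u (1, 0)) (int a' * M) \<and>
     ext_power p d e v' (int b' * M) = ext_power p d e v (int b' * M) \<and>
     ext_power p d e (ext_minus p v' (1, 0)) (int b' * M) =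
       ext_power p d e (ext_minus p v (1, 0)) (int b' * M) \<and>
     ext_power p d e (ext_minus p u' v') M = ext_power p d e (ext_minus p u v) M \<and>
     (if a = b then True
      else ext_power p d e (ext_minus p u' v) M = ext_power p d e (ext_minus p u v) M) \<and>
     (if b mod a = 0 then True
      else ext_power p d e (ext_minus p u v') M = ext_power p d e (ext_minus p u v) M) \<and>
     ext_nonzero p d e q [u, v, ext_minus p u (1, 0), ext_minus p v (1, 0), ext_minus p u u',
       ext_minus p v v', ext_minus p u v])"

section \<open>Evaluation of integer pairs in the field\<close>

context
  fixes p d e :: int and \<alpha> :: "'a::{field,finite}"
  assumes char: "of_int p = (0::'a)" and root: "\<alpha> * \<alpha> = of_int d + of_int e * \<alpha>"
begin

lemma of_int_mod_char: "of_int (x mod p) = (of_int x :: 'a)"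
proof -
  have "of_int x = (of_int (p * (x div p) + x mod p) :: 'a)" by simp
  then show ?thesis by (simp only: of_int_add of_int_mult char) simp
qed

lemma ext_value_mult: "ext_value \<alpha> (ext_mult p d e v w) = ext_value \<alpha> v * ext_value \<alpha> w"
proof (cases v; cases w)
  fix x y x' y' assume vw: "v = (x, y)" "w = (x', y')"
  have "ext_value \<alpha> v * ext_value \<alpha> w = of_int x * of_int x' +
      (of_int x * of_int y' + of_int y * of_int x') * \<alpha> + of_int y * of_int y' * (\<alpha> * \<alpha>)"
    by (simp add: vw ext_value_def algebra_simps)
  also have "\<dots> = ext_value \<alpha> (ext_mult p d e v w)"
    unfolding root by (simp add: vw ext_value_def of_int_mod_char algebra_simps)
  finally show ?thesis by simp
qed

lemma ext_value_square: "ext_value \<alpha> (ext_square p d e v) = ext_value \<alpha> v * ext_value \<alpha> v"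
proof -
  have "ext_square p d e v = ext_mult p d e v v" by (cases v) (simp add: algebra_simps)
  then show ?thesis by (simp add: ext_value_mult)
qed

lemma ext_value_minus: "ext_value \<alpha> (ext_minus p v w) = ext_value \<alpha> v - ext_value \<alpha> w"
  by (cases v; cases w) (simp add: ext_value_def of_int_mod_char left_diff_distrib)

lemma ext_value_one [simp]: "ext_value \<alpha> (1, 0) = 1"
  by (simp add: ext_value_def)

lemma ext_value_power:
  "n \<ge> 1 \<Longrightarrow> ext_value \<alpha> (ext_power p d e v n) = ext_value \<alpha> v ^ nat n"
proof (induction "nat n" arbitrary: n rule: less_induct)
  case less
  show ?case
  proof (cases "n = 1")
    case True
    then show ?thesis by (simp add: ext_power.simps)
  next
    case False
    then have n: "n \<ge> 2" using less.prems by simp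
    have IH: "ext_value \<alpha> (ext_power p d e v (n div 2)) = ext_value \<alpha> v ^ nat (n div 2)"
      using n by (intro less.hyps) auto
    have sq: "(ext_value \<alpha> v ^ nat (n div 2)) * (ext_value \<alpha> v ^ nat (n div 2)) = ext_value \<alpha> v ^ (2 * nat (n div 2))"
      by (simp add: mult_2 power_add)
    have even: "nat n = 2 * nat (n div 2)" if "n mod 2 = 0"
    proof -
      have "n = 2 * (n div 2)" using that div_mult_mod_eq[of n 2] by linarith
      then show ?thesis using n by (metis nat_mult_distrib nat_numeral zero_le_numeral)
    qed
    have odd: "nat n = Suc (2 * nat (n div 2))" if "n mod 2 \<noteq> 0"
    proof -
      have "n mod 2 = 1" using that by (simp add: mod_2_eq_odd)
      then have "n = 2 * (n div 2) + 1" using div_mult_mod_eq[of n 2] by linarith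
      moreover have "n div 2 \<ge> 0" using n by simp
      ultimately show ?thesis by linarith
    qed
    show ?thesis
      using n even odd
      by (subst ext_power.simps) (simp add: ext_value_mult ext_value_square IH sq)
  qed
qed

lemma ext_value_prod: "ext_value \<alpha> (ext_prod p d e vs) = prod_list (map (ext_value \<alpha>) vs)"
  by (induction vs) (simp_all add: ext_value_mult)

lemma ext_value_minus_list: "map (ext_value \<alpha>) (ext_minus_list p v ws) = map (\<lambda>w. w - ext_value \<alpha> v) (map (ext_value \<alpha>) ws)"
  by (induction ws) (simp_all add: ext_value_minus)

lemma ext_value_minus_lists:
  "map (ext_value \<alpha>) (ext_minus_lists p vs ws) = map2 (-) (map (ext_value \<alpha>) vs) (map (ext_value \<alpha>) ws)"
proof (induction vs arbitrary: ws)
  case (Cons v vs)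
  then show ?case by (cases ws) (simp_all add: ext_value_minus)
qed simp

lemma distinct_if_differences_nonzero:
  "0 \<notin> ext_value \<alpha> ` set (ext_differences p vs) \<Longrightarrow> distinct (map (ext_value \<alpha>) vs)"
proof (induction vs)
  case (Cons v vs)
  have "set (map (ext_value \<alpha>) (ext_minus_list p v vs)) = (\<lambda>w. w - ext_value \<alpha> v) ` ext_value \<alpha> ` set vs"
    unfolding ext_value_minus_list by (simp add: image_image)
  then show ?case using Cons by (auto simp: image_Un)
qed simp

lemma ext_value_weights:
  assumes "M \<ge> 1"
  shows "map (ext_value \<alpha>) (ext_weights p d e M z \<zeta> ms) =
    map (\<lambda>i. ext_value \<alpha> z * ext_value \<alpha> \<zeta> ^ i * map (ext_value \<alpha>) ms ! i ^ nat M) [0..<length ms]"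
proof (induction ms arbitrary: z)
  case (Cons m ms)
  show ?case
    using assms by (simp add: Cons.IH ext_value_mult ext_value_power upt_conv_Cons map_Suc_upt[symmetric]
        mult.assoc del: upt_Suc)
qed simp

lemma multipliers_ok_if_nonzero:
  assumes "M \<ge> 1" "0 \<notin> ext_value \<alpha> ` set (ext_multipliers p d e M \<zeta> ms)"
  shows "multipliers_ok (nat M) (ext_value \<alpha> \<zeta>) (map (ext_value \<alpha>) ms)"
  using distinct_if_differences_nonzero[of "ext_weights p d e M (1, 0) \<zeta> ms"] assms
  by (auto simp: multipliers_ok_def weights_def ext_multipliers_def ext_value_weights image_Un)

lemma ext_nonzero_imp:
  assumes "ext_nonzero p d e q vs" "q \<ge> 2"
  shows "0 \<notin> ext_value \<alpha> ` set vs"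
proof -
  have "prod_list (map (ext_value \<alpha>) vs) ^ nat (q - 1) = 1"
    using assms ext_value_power[of "q - 1" "ext_prod p d e vs"] by (simp add: ext_nonzero_def ext_value_prod)
  moreover have "nat (q - 1) > 0" using assms(2) by simp
  ultimately have "prod_list (map (ext_value \<alpha>) vs) \<noteq> 0" by (metis power_0_left not_gr0 zero_neq_one)
  then show ?thesis by (auto simp: prod_list_zero_iff)
qed

end

lemma ext_list_check_sound:
  fixes g \<alpha> :: "'a::{field,finite}"
  assumes gen: "field_generator g"
    and ext: "of_int p = (0::'a)" "\<alpha> * \<alpha> = of_int d + of_int e * \<alpha>"
    and c: "c * M = CARD('a) - 1" "a * a' = c" "b * b' = c"
    and len: "length us = a" "length vs = b"
    and check: "ext_list_check p d e (int CARD('a)) a' b' (int M) \<zeta> us vs"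
  shows "has_orthogonal_pair g a b"
proof -
  let ?ev = "ext_value \<alpha>" and ?q = "int CARD('a)"
  have pos: "c > 0" "M > 0" using index_factors_pos[OF c(1)] by auto
  then have pos': "a' > 0" "b' > 0" using c by (auto intro: gr0I)
  have q: "?q \<ge> 2" using card_field_gt_1[where 'a = 'a] by simp
  have "?q - 1 = int (c * M)" unfolding c(1) using q by simp
  then have qM: "(?q - 1) div int M = int c" using pos by simp
  note value_rules = ext_value_power[OF ext] ext_value_minus_list[OF ext] ext_value_minus_lists[OF ext]
    ext_value_one[OF ext]
  \<comment> \<open>Membership in the long appended list is split into a conjunction, with one part
    for each block of the product.\<close>
  note nz = ext_nonzero_imp[OF ext conjunct2[OF check[unfolded ext_list_check.simps]] q,
      unfolded set_append image_Un Un_iff de_Morgan_disj qM]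
  have nat_eq: "nat (int a' * int M) = a' * M" "nat (int b' * int M) = b' * M"
    by (simp_all flip: of_nat_mult)
  have ge: "int a' * int M \<ge> 1" "int b' * int M \<ge> 1" "int M \<ge> 1" "int a' \<ge> 1" "int b' \<ge> 1"
    using pos pos' by (simp_all flip: of_nat_mult)
  note ok = multipliers_ok_if_nonzero[OF ext]
  have inj: "inj_on (\<lambda>i. ?ev \<zeta> ^ i) {..<c}"
  proof -
    have "distinct (map ?ev (ext_weights p d e 1 (1, 0) \<zeta> (replicate (nat (int c)) (1, 0))))"
      using nz by (intro distinct_if_differences_nonzero[OF ext]) blast
    then show ?thesis
      by (simp add: ext_value_weights[OF ext] value_rules distinct_map inj_on_def lessThan_atLeast0)
  qed
  have roots: "?ev \<zeta> ^ c = 1"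
    using conjunct1[OF check[unfolded ext_list_check.simps]] pos value_rules(1)[of "int c" \<zeta>]
    by (simp add: qM value_rules)
  show ?thesis
  proof (rule has_orthogonal_pair_lists[OF gen c, where us = "map ?ev us" and vs = "map ?ev vs"])
    show "multipliers_ok (a' * M) (?ev \<zeta> ^ a') (map ?ev us)"
      using ok[OF ge(1), of "ext_power p d e \<zeta> (int a')" us] nz ge by (simp add: nat_eq value_rules)
    show "multipliers_ok (a' * M) (?ev \<zeta> ^ a') (map (\<lambda>u. u - 1) (map ?ev us))"
      using ok[OF ge(1), of "ext_power p d e \<zeta> (int a')" "ext_minus_list p (1, 0) us"] nz ge
      unfolding value_rules by (simp add: nat_eq value_rules)
    show "multipliers_ok (b' * M) (?ev \<zeta> ^ b') (map ?ev vs)"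
      using ok[OF ge(2), of "ext_power p d e \<zeta> (int b')" vs] nz ge by (simp add: nat_eq value_rules)
    show "multipliers_ok (b' * M) (?ev \<zeta> ^ b') (map (\<lambda>u. u - 1) (map ?ev vs))"
      using ok[OF ge(2), of "ext_power p d e \<zeta> (int b')" "ext_minus_list p (1, 0) vs"] nz ge
      unfolding value_rules by (simp add: nat_eq value_rules)
    have conc: "concat (replicate n (map ?ev ms)) = map ?ev (concat (replicate n ms))" for n ms
      by (simp add: map_concat map_replicate)
    show "multipliers_ok M (?ev \<zeta>)
        (map2 (-) (concat (replicate a' (map ?ev us))) (concat (replicate b' (map ?ev vs))))"
      using ok[OF ge(3), of \<zeta> "ext_minus_lists p (concat (replicate a' us)) (concat (replicate b' vs))"] nz
      unfolding conc value_rules by simp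
    have hd: "hd (map ?ev ms) \<notin> set (tl (map ?ev ms))"
      if "0 \<notin> ?ev ` set (ext_minus_list p (hd ms) (tl ms))" for ms
    proof (cases ms)
      case (Cons m ms')
      have "?ev ` set (ext_minus_list p m ms') = (\<lambda>w. w - ?ev m) ` ?ev ` set ms'"
        using arg_cong[OF ext_value_minus_list[OF ext], of set m ms'] by (simp add: image_image)
      then show ?thesis using that Cons by auto
    qed (use pos pos' in simp)
    show "hd (map ?ev us) \<notin> set (tl (map ?ev us))" "hd (map ?ev vs) \<notin> set (tl (map ?ev vs))"
      using nz by (auto intro!: hd)
  qed (use inj roots len in simp_all)
qed

lemma ext_pair_check_sound:
  fixes g \<alpha> :: "'a::{field,finite}"
  assumes gen: "field_generator g"
    and ext: "of_int p = (0::'a)" "\<alpha> * \<alpha> = of_int d + of_int e * \<alpha>"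
    and c: "c * M = CARD('a) - 1" "a * a' = c" "b * b' = c" and ab: "1 < a" "1 < b"
    and check: "ext_pair_check p d e (int CARD('a)) a b a' b' (int M) u u' v v'"
  shows "has_orthogonal_pair g a b"
proof -
  let ?ev = "ext_value \<alpha>"
  have pos: "c > 0" "M > 0" using index_factors_pos[OF c(1)] by auto
  then have pos': "a' > 0" "b' > 0" using c by (auto intro: gr0I)
  have q: "int CARD('a) \<ge> 2" using card_field_gt_1[where 'a = 'a] by simp
  have ge: "int a' * int M \<ge> 1" "int b' * int M \<ge> 1" "int M \<ge> 1"
    using pos pos' by (simp_all flip: of_nat_mult)
  have pow: "?ev x ^ n = ?ev y ^ n"
    if "ext_power p d e x (int n) = ext_power p d e y (int n)" "n > 0" for x y n
    using that ext_value_power[OF ext, of "int n" x] ext_value_power[OF ext, of "int n" y] by simp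
  have nz: "ext_nonzero p d e (int CARD('a)) [u, v, ext_minus p u (1, 0), ext_minus p v (1, 0),
      ext_minus p u u', ext_minus p v v', ext_minus p u v]"
    using check by simp
  have ne: "?ev u \<noteq> 0" "?ev v \<noteq> 0" "?ev u - 1 \<noteq> 0" "?ev v - 1 \<noteq> 0" "?ev u - ?ev u' \<noteq> 0"
    "?ev v - ?ev v' \<noteq> 0" "?ev u - ?ev v \<noteq> 0"
    using ext_nonzero_imp[OF ext nz q] by (auto simp: ext_value_minus[OF ext] ext_value_one[OF ext])
  have P: "a' * M > 0" "b' * M > 0" "M > 0" using pos pos' by simp_all
  have eqs:
    "ext_power p d e u' (int (a' * M)) = ext_power p d e u (int (a' * M))"
    "ext_power p d e (ext_minus p u' (1, 0)) (int (a' * M)) = ext_power p d e (ext_minus p u (1, 0)) (int (a' * M))"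
    "ext_power p d e v' (int (b' * M)) = ext_power p d e v (int (b' * M))"
    "ext_power p d e (ext_minus p v' (1, 0)) (int (b' * M)) = ext_power p d e (ext_minus p v (1, 0)) (int (b' * M))"
    "ext_power p d e (ext_minus p u' v') (int M) = ext_power p d e (ext_minus p u v) (int M)"
    "a \<noteq> b \<Longrightarrow> ext_power p d e (ext_minus p u' v) (int M) = ext_power p d e (ext_minus p u v) (int M)"
    "\<not> a dvd b \<Longrightarrow> ext_power p d e (ext_minus p u v') (int M) = ext_power p d e (ext_minus p u v) (int M)"
    using check by (auto simp: dvd_eq_mod_eq_0 split: if_splits)
  note res = pow[OF eqs(1) P(1)] pow[OF eqs(2) P(1)] pow[OF eqs(3) P(2)] pow[OF eqs(4) P(2)]
    pow[OF eqs(5) P(3)] pow[OF eqs(6) P(3)] pow[OF eqs(7) P(3)]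
  show ?thesis
    using ne res unfolding ext_value_minus[OF ext] ext_value_one[OF ext]
    by (intro has_orthogonal_pair_two_multipliers[OF gen c ab, where u = "?ev u" and u' = "?ev u'"
          and v = "?ev v" and v' = "?ev v'"]) auto
qed

section \<open>Witnesses for small fields\<close>

text \<open>An entry \<open>(p, q, u, u', v, v')\<close> has its multipliers in the prime field of a field of order \<open>q\<close>.\<close>

fun pair_table_check :: "nat \<Rightarrow> nat \<Rightarrow> nat \<Rightarrow> nat \<Rightarrow> int \<Rightarrow> (int \<times> int \<times> int \<times> int \<times> int \<times> int) list \<Rightarrow> bool" where
  "pair_table_check a b a' b' c [] = True"
| "pair_table_check a b a' b' c ((p, q, u, u', v, v') # ws) =
     (if (q = p \<or> q = p * p) \<and>
         ext_pair_check p 0 0 q a b a' b' ((q - 1) div c) (u, 0) (u', 0) (v, 0) (v', 0)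
      then pair_table_check a b a' b' c ws else False)"

lemma card_power_eq_0:
  assumes "CARD('a::{field,finite}) = p ^ n"
  shows "of_int (int p) = (0::'a)"
proof -
  have "of_nat CARD('a) = (0::'a)" by (simp add: of_nat_eq_0_iff_char_dvd CHAR_dvd_CARD)
  then show ?thesis using assms by simp
qed

lemma pair_table_check_sound:
  fixes g :: "'a::{field,finite}"
  assumes gen: "field_generator g" and table: "pair_table_check a b a' b' (int c) ws"
    and q: "int CARD('a) \<in> set (map (\<lambda>(p, q, w). q) ws)"
    and c: "c dvd CARD('a) - 1" "a * a' = c" "b * b' = c" and ab: "1 < a" "1 < b"
  shows "has_orthogonal_pair g a b"
proof -
  obtain p u u' v v' where w: "(p, int CARD('a), u, u', v, v') \<in> set ws" using q by auto
  have "int CARD('a) - 1 = int (CARD('a) - 1)"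
    using card_field_gt_1[where 'a = 'a] by simp
  then have M: "(int CARD('a) - 1) div int c = int ((CARD('a) - 1) div c)"
    by (simp only: zdiv_int)
  have check: "(int CARD('a) = p \<or> int CARD('a) = p * p) \<and>
      ext_pair_check p 0 0 (int CARD('a)) a b a' b' ((int CARD('a) - 1) div int c)
      (u, 0) (u', 0) (v, 0) (v', 0)"
    using table w
    by (induction a b a' b' "int c" ws rule: pair_table_check.induct)
       (auto simp del: ext_pair_check.simps split: if_splits)
  \<comment> \<open>The cardinality vanishes in the field and equals p or p * p, hence p vanishes
    too.\<close>
  have "of_int (int CARD('a)) = (0::'a)" using card_power_eq_0[where 'a = 'a, of "CARD('a)" 1] by simp
  then have "of_int p = (0::'a) \<or> of_int (p * p) = (0::'a)" using check by metis
  then have p: "of_int p = (0::'a)" by simp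
  show ?thesis
    using check c(1) unfolding M
    by (intro ext_pair_check_sound[OF gen p _ _ c(2,3) ab, where \<alpha> = 0 and d = 0 and e = 0 and M = "(CARD('a) - 1) div c"
          and u = "(u, 0)" and u' = "(u', 0)" and v = "(v, 0)" and v' = "(v', 0)"])
       (simp_all del: ext_pair_check.simps)
qed

lemma pair_table_2_2: "pair_table_check 2 2 1 1 2
    [(11, 11, 2, 6, 6, 10)]"
  by code_simp

text \<open>For even M one can take v = u' and v' = u: then u' - v' is -(u - v), which has the same
  M-th power, and only the ratios of u to u' and of u - 1 to u' - 1 have to be residues. Most
  diagonal entries have this form.\<close>

lemma pair_table_3_3: "pair_table_check 3 3 1 1 3
    [(13, 13, 3, 11, 11, 3), (19, 19, 3, 17, 17, 3), (5, 25, 2, 3, 3, 2)]"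
  by code_simp

lemma pair_table_4_4: "pair_table_check 4 4 1 1 4
    [(17, 17, 4, 13, 13, 4), (29, 29, 2, 17, 21, 2), (37, 37, 3, 21, 25, 3), (41, 41, 2, 5, 5, 2),
     (7, 49, 2, 3, 3, 2), (53, 53, 2, 45, 48, 2), (61, 61, 2, 23, 26, 2)]"
  by code_simp

lemma pair_table_5_5: "pair_table_check 5 5 1 1 5
    [(31, 31, 3, 13, 13, 3), (41, 41, 2, 28, 28, 2), (61, 61, 2, 22, 22, 2), (71, 71, 2, 31, 31, 2),
     (101, 101, 2, 37, 37, 2)]"
  by code_simp

lemma pair_table_6_6: "pair_table_check 6 6 1 1 6
    [(5, 25, 2, 3, 3, 2), (31, 31, 3, 17, 7, 25), (37, 37, 4, 34, 34, 4), (43, 43, 2, 22, 22, 42),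
     (61, 61, 2, 21, 21, 2), (67, 67, 3, 45, 54, 6), (73, 73, 2, 25, 25, 2), (79, 79, 3, 37, 43,
     77), (97, 97, 3, 44, 44, 3), (103, 103, 3, 27, 27, 69), (109, 109, 2, 17, 17, 2), (11, 121, 2,
     3, 3, 2), (127, 127, 3, 48, 48, 101), (139, 139, 2, 126, 130, 2), (151, 151, 2, 21, 21, 99),
     (157, 157, 2, 28, 28, 2), (163, 163, 2, 7, 137, 2), (13, 169, 3, 11, 11, 3), (181, 181, 2, 47,
     47, 2), (193, 193, 2, 28, 28, 2), (199, 199, 2, 29, 29, 122), (211, 211, 2, 26, 26, 110)]"
  by code_simp

lemma pair_table_2_4: "pair_table_check 2 4 2 1 4
    [(17, 17, 2, 9, 11, 7), (29, 29, 2, 8, 9, 28), (37, 37, 2, 5, 24, 18), (41, 41, 2, 5, 10, 37),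
     (7, 49, 2, 3, 4, 2), (53, 53, 2, 5, 45, 48), (61, 61, 2, 6, 3, 19), (73, 73, 2, 3, 36, 71)]"
  by code_simp

text \<open>If q = p^2 and c divides p + 1, as for 25 and 121 here, then p - 1 divides M. All
  nonzero elements of the prime field have M-th power 1, so very small multipliers work.\<close>

lemma pair_table_2_6: "pair_table_check 2 6 3 1 6
    [(5, 25, 2, 3, 4, 2), (31, 31, 2, 19, 17, 3), (37, 37, 5, 2, 22, 17), (43, 43, 3, 20, 42, 22),
     (61, 61, 2, 6, 5, 15), (67, 67, 2, 7, 10, 65), (73, 73, 2, 3, 40, 15), (79, 79, 2, 5, 39, 68),
     (97, 97, 2, 3, 62, 32), (103, 103, 2, 8, 73, 94), (109, 109, 2, 6, 4, 82), (11, 121, 2, 3, 4,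
     2), (127, 127, 2, 9, 4, 25), (139, 139, 2, 8, 84, 82), (151, 151, 2, 5, 42, 74), (157, 157, 2,
     5, 65, 112), (163, 163, 2, 5, 68, 73)]"
  by code_simp

lemma pair_table_2_3: "pair_table_check 2 3 3 2 6
    [(37, 37, 10, 27, 4, 33), (43, 43, 2, 18, 9, 36), (61, 61, 2, 17, 21, 59), (67, 67, 2, 5, 27,
     64), (73, 73, 2, 4, 30, 49), (79, 79, 2, 5, 39, 68), (97, 97, 2, 3, 40, 59), (103, 103, 2, 8,
     56, 86), (109, 109, 2, 6, 27, 90), (11, 121, 2, 3, 4, 5), (127, 127, 2, 9, 20, 51), (139, 139,
     2, 8, 58, 117), (151, 151, 2, 5, 42, 102), (157, 157, 2, 5, 65, 99), (163, 163, 2, 5, 68, 75)]"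
  by code_simp

lemma pair_table_3_6: "pair_table_check 3 6 2 1 6
    [(5, 25, 2, 3, 4, 2), (31, 31, 14, 12, 25, 7), (37, 37, 2, 12, 7, 30), (43, 43, 3, 23, 2, 22),
     (61, 61, 2, 39, 5, 48), (67, 67, 2, 10, 11, 7), (73, 73, 2, 18, 62, 5), (79, 79, 2, 13, 37,
     43), (97, 97, 2, 13, 28, 34), (103, 103, 2, 25, 51, 5), (109, 109, 2, 17, 5, 106), (11, 121, 2,
     3, 4, 2), (127, 127, 2, 5, 95, 123), (139, 139, 2, 9, 5, 31), (151, 151, 2, 21, 135, 114),
     (157, 157, 2, 8, 59, 65), (163, 163, 2, 7, 95, 4), (181, 181, 2, 9, 134, 123), (193, 193, 2,
     15, 16, 6), (199, 199, 2, 13, 65, 2), (211, 211, 2, 19, 14, 6), (223, 223, 2, 8, 16, 15), (229,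
     229, 2, 16, 109, 122), (241, 241, 2, 7, 206, 42), (271, 271, 2, 11, 104, 3), (277, 277, 2, 16,
     3, 252), (283, 283, 2, 16, 79, 39), (17, 289, 2, 3, 4, 2), (307, 307, 2, 3, 19, 4), (313, 313,
     2, 9, 76, 140), (331, 331, 2, 13, 119, 23), (337, 337, 2, 9, 259, 253)]"
  by code_simp

lemma ext_pair_2_2_9: "ext_pair_check 3 2 0 9 2 2 1 1 4 (0, 1) (0, 2) (0, 2) (0, 1)"
  by code_simp

lemma ext_pair_4_4_25: "ext_pair_check 5 2 0 25 4 4 1 1 6 (0, 1) (0, 4) (0, 4) (0, 1)"
  by code_simp

text \<open>The multipliers lie in the subfield of order 4, whose nonzero elements have third power
  1. Likewise for q = 81 below: the subfield has order 9, and M = 16 is a multiple of 8.\<close>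

lemma ext_pair_5_5_16: "ext_pair_check 2 1 1 16 5 5 1 1 3 (0, 1) (1, 1) (1, 1) (0, 1)"
  by code_simp

lemma ext_pair_5_5_81: "ext_pair_check 3 2 0 81 5 5 1 1 16 (2, 0) (0, 1) (0, 1) (2, 0)"
  by code_simp

lemma ext_pair_5_5_121: "ext_pair_check 11 2 0 121 5 5 1 1 24 (2, 0) (9, 2) (9, 2) (2, 0)"
  by code_simp

lemma ext_pair_6_6_49: "ext_pair_check 7 3 0 49 6 6 1 1 8 (0, 1) (0, 6) (0, 6) (0, 1)"
  by code_simp

lemma ext_pair_2_4_25: "ext_pair_check 5 2 0 25 2 4 2 1 6 (2, 0) (3, 0) (0, 1) (0, 4)"
  by code_simp

lemma ext_pair_2_6_49: "ext_pair_check 7 3 0 49 2 6 3 1 8 (2, 0) (3, 0) (6, 1) (6, 6)"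
  by code_simp

lemma ext_pair_2_3_25: "ext_pair_check 5 2 0 25 2 3 3 2 4 (3, 0) (3, 2) (3, 3) (3, 4)"
  by code_simp

lemma ext_pair_2_3_49: "ext_pair_check 7 3 0 49 2 3 3 2 8 (2, 0) (3, 0) (6, 2) (6, 5)"
  by code_simp

lemma ext_pair_3_6_49: "ext_pair_check 7 3 0 49 3 6 2 1 8 (3, 2) (2, 0) (1, 6) (1, 1)"
  by code_simp

lemma ext_pair_3_6_169: "ext_pair_check 13 2 0 169 3 6 2 1 28 (2, 0) (10, 1) (12, 3) (3, 10)"
  by code_simp

text \<open>Two multipliers cannot work for odd q and M = 2: equal squares of u, u' and of u - 1, u'
  - 1 would mean u' = -u and u' - 1 = -(u - 1), hence 2 = 0. So a separate multiplier for each class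
  is allowed here.\<close>

lemma ext_list_4_4_9: "ext_list_check 3 2 0 9 1 1 2 (0, 1)
    [(2, 0), (0, 1), (2, 2), (1, 1)]
    [(0, 1), (1, 1), (1, 2), (0, 2)]"
  by code_simp

lemma ext_list_4_4_13: "ext_list_check 13 0 0 13 1 1 3 (5, 0)
    [(2, 0), (5, 0), (6, 0), (6, 0)]
    [(9, 0), (12, 0), (5, 0), (2, 0)]"
  by code_simp

lemma ext_list_5_5_11: "ext_list_check 11 0 0 11 1 1 2 (3, 0)
    [(2, 0), (5, 0), (6, 0), (8, 0), (8, 0)]
    [(5, 0), (7, 0), (4, 0), (9, 0), (9, 0)]"
  by code_simp

lemma ext_list_6_6_13: "ext_list_check 13 0 0 13 1 1 2 (4, 0)
    [(2, 0), (3, 0), (3, 0), (12, 0), (12, 0), (5, 0)]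
    [(4, 0), (5, 0), (6, 0), (8, 0), (6, 0), (12, 0)]"
  by code_simp

lemma ext_list_6_6_19: "ext_list_check 19 0 0 19 1 1 3 (8, 0)
    [(2, 0), (3, 0), (3, 0), (3, 0), (4, 0), (7, 0)]
    [(3, 0), (4, 0), (9, 0), (13, 0), (14, 0), (14, 0)]"
  by code_simp

lemma ext_list_2_4_13: "ext_list_check 13 0 0 13 2 1 3 (5, 0)
    [(2, 0), (5, 0)]
    [(7, 0), (6, 0), (3, 0), (3, 0)]"
  by code_simp

lemma ext_list_2_6_19: "ext_list_check 19 0 0 19 3 1 3 (8, 0)
    [(2, 0), (8, 0)]
    [(3, 0), (5, 0), (5, 0), (11, 0), (7, 0), (12, 0)]"
  by code_simp

lemma ext_list_2_3_19: "ext_list_check 19 0 0 19 3 2 3 (8, 0)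
    [(2, 0), (8, 0)]
    [(4, 0), (6, 0), (6, 0)]"
  by code_simp

lemma ext_list_2_3_31: "ext_list_check 31 0 0 31 3 2 5 (6, 0)
    [(2, 0), (5, 0)]
    [(6, 0), (7, 0), (17, 0)]"
  by code_simp

lemma ext_list_3_6_13: "ext_list_check 13 0 0 13 2 1 2 (4, 0)
    [(2, 0), (3, 0), (10, 0)]
    [(3, 0), (4, 0), (5, 0), (8, 0), (10, 0), (4, 0)]"
  by code_simp

lemma ext_list_3_6_19: "ext_list_check 19 0 0 19 2 1 3 (8, 0)
    [(2, 0), (3, 0), (5, 0)]
    [(3, 0), (5, 0), (7, 0), (7, 0), (6, 0), (15, 0)]"
  by code_simp

section \<open>Exhaustive search in small fields\<close>

fun fresh :: "'b \<Rightarrow> 'b list \<Rightarrow> bool" where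
  "fresh v [] = True"
| "fresh v (w # ws) = (if v = w then False else fresh v ws)"

text \<open>Each list holds the entries \<open>(t, a, b, c)\<close> for one argument \<open>x\<close>: a candidate value \<open>t\<close> with codes of
  \<open>t\<close>, \<open>t - x\<close> and \<open>t - s\<close>, where \<open>s\<close> is the value of the other map. No code may occur twice.\<close>

function backtrack :: "('b list \<Rightarrow> bool) \<Rightarrow> ('b \<times> 'c \<times> 'c \<times> 'c) list list \<Rightarrow> 'c list \<Rightarrow> 'c list \<Rightarrow> 'c list \<Rightarrow>
    'b list \<Rightarrow> bool" where
  "backtrack P [] A B C ts = P ts"
| "backtrack P ([] # ess) A B C ts = True"
| "backtrack P (((t, a, b, c) # es) # ess) A B C ts =
     (if fresh a A then
        if fresh b B then
          if fresh c C then
            if backtrack P ess (a # A) (b # B) (c # C) (ts @ [t])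
            then backtrack P (es # ess) A B C ts
            else False
          else backtrack P (es # ess) A B C ts
        else backtrack P (es # ess) A B C ts
      else backtrack P (es # ess) A B C ts)"
  by pat_completeness auto
termination
  by (relation "inv_image (less_than <*lex*> less_than)
        (\<lambda>(P, ess, A, B, C, ts). (length ess, case ess of [] \<Rightarrow> 0 | es # _ \<Rightarrow> length es))") auto

text \<open>If \<open>sg\<close> is set, then the maps are odd: only one of \<open>x\<close>, \<open>-x\<close> is recorded, and values are
  compared up to sign, by means of their squares.\<close>

fun pack :: "int \<Rightarrow> int \<times> int \<Rightarrow> int" where
  "pack p (x, y) = x + p * y"

text \<open>Subtracting (0, 0) only reduces both coordinates modulo p, as the injectivity of
  \<open>pack\<close> requires.\<close>

definition residue_code :: "int \<Rightarrow> int \<Rightarrow> int \<Rightarrow> bool \<Rightarrow> int \<times> int \<Rightarrow> int" where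
  "residue_code p d e sg v = pack p (if sg then ext_square p d e v else ext_minus p v (0, 0))"

text \<open>The map, its difference to the identity and its difference to the other map are
  injective and vanish at 0. At a nonzero argument x its value is therefore none of 0, x and
  s.\<close>

fun entries :: "int \<Rightarrow> int \<Rightarrow> int \<Rightarrow> bool \<Rightarrow> int \<times> int \<Rightarrow> int \<times> int \<Rightarrow> (int \<times> int) list \<Rightarrow>
    ((int \<times> int) \<times> int \<times> int \<times> int) list" where
  "entries p d e sg x s [] = []"
| "entries p d e sg x s (t # cs) =
     (if t = (0, 0) then entries p d e sg x s cs
      else if t = x then entries p d e sg x s cs
      else if t = s then entries p d e sg x s cs
      else (t, residue_code p d e sg t, residue_code p d e sg (ext_minus p t x),
        residue_code p d e sg (ext_minus p t s)) # entries p d e sg x s cs)"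

fun entry_lists :: "int \<Rightarrow> int \<Rightarrow> int \<Rightarrow> bool \<Rightarrow> (int \<times> int) list \<Rightarrow> (int \<times> int) list \<Rightarrow> (int \<times> int) list \<Rightarrow>
    ((int \<times> int) \<times> int \<times> int \<times> int) list list" where
  "entry_lists p d e sg cs (x # xs) (s # ss) = entries p d e sg x s cs # entry_lists p d e sg cs xs ss"
| "entry_lists p d e sg cs xs ss = []"

text \<open>P is to hold for the value list of every orthomorphism fixing 0 that is orthogonal to
  the map with values \<open>ss\<close> at \<open>xs\<close>.\<close>

definition mates_satisfy :: "int \<Rightarrow> int \<Rightarrow> int \<Rightarrow> bool \<Rightarrow> (int \<times> int) list \<Rightarrow>
    ((int \<times> int) list \<Rightarrow> bool) \<Rightarrow> (int \<times> int) list \<Rightarrow> (int \<times> int) list \<Rightarrow> bool" where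
  "mates_satisfy p d e sg cs P xs ss =
     backtrack P (entry_lists p d e sg cs xs ss) [] [] [] []"

fun zeros :: "(int \<times> int) list \<Rightarrow> (int \<times> int) list" where
  "zeros [] = []"
| "zeros (x # xs) = (0, 0) # zeros xs"

definition elements :: "int \<Rightarrow> bool \<Rightarrow> (int \<times> int) list \<Rightarrow> (int \<times> int) list" where
  "elements p sg xs = (0, 0) # xs @ (if sg then ext_minus_lists p (zeros xs) xs else [])"

text \<open>Ratios are compared by cross multiplication, since inverses of pairs are not
  computed.\<close>

fun same_ratio :: "int \<Rightarrow> int \<Rightarrow> int \<Rightarrow> int \<times> int \<Rightarrow> int \<times> int \<Rightarrow> (int \<times> int) list \<Rightarrow> (int \<times> int) list \<Rightarrow> bool" where
  "same_ratio p d e x t (y # ys) (u # us) =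
     (if ext_mult p d e t y = ext_mult p d e u x then same_ratio p d e x t ys us else False)"
| "same_ratio p d e x t ys us = True"

fun proportional :: "int \<Rightarrow> int \<Rightarrow> int \<Rightarrow> (int \<times> int) list \<Rightarrow> (int \<times> int) list \<Rightarrow> bool" where
  "proportional p d e (x # xs) (u # us) = same_ratio p d e x u xs us"
| "proportional p d e xs us = True"

definition linear_or_linear_mates :: "int \<Rightarrow> int \<Rightarrow> int \<Rightarrow> (int \<times> int) list \<Rightarrow> (int \<times> int) list \<Rightarrow> bool" where
  "linear_or_linear_mates p d e xs us =
     (if proportional p d e xs us then True
      else mates_satisfy p d e False (elements p False xs) (proportional p d e xs) xs us)"

text \<open>With the zero map as the other map, the third condition of the search repeats the first,
  so the outer search runs over all orthomorphisms fixing 0.\<close>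

definition no_nonlinear_pair :: "int \<Rightarrow> int \<Rightarrow> int \<Rightarrow> (int \<times> int) list \<Rightarrow> bool" where
  "no_nonlinear_pair p d e xs =
     mates_satisfy p d e False (elements p False xs) (linear_or_linear_mates p d e xs) xs (zeros xs)"

fun scale :: "int \<Rightarrow> int \<Rightarrow> int \<Rightarrow> int \<times> int \<Rightarrow> (int \<times> int) list \<Rightarrow> (int \<times> int) list" where
  "scale p d e m [] = []"
| "scale p d e m (x # xs) = ext_mult p d e m x # scale p d e m xs"

text \<open>In the applications \<open>xs\<close> and \<open>ys\<close> represent the squares and
  the nonsquares up to sign, so this says that an odd map has index 2.\<close>

definition quadratic_values :: "int \<Rightarrow> int \<Rightarrow> int \<Rightarrow> (int \<times> int) list \<Rightarrow> (int \<times> int) list \<Rightarrow> (int \<times> int) list \<Rightarrow> bool" where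
  "quadratic_values p d e xs ys us =
     (if proportional p d e xs (take (length xs) us) then proportional p d e ys (drop (length xs) us) else False)"

fun fresh_residues :: "int \<Rightarrow> int \<Rightarrow> int \<Rightarrow> (int \<times> int) list \<Rightarrow> (int \<times> int) list \<Rightarrow> bool" where
  "fresh_residues p d e [] A = True"
| "fresh_residues p d e (v # vs) A =
     (if fresh (ext_square p d e v) A then fresh_residues p d e vs (ext_square p d e v # A) else False)"

text \<open>The two freshness tests discard pairs of multipliers that do not give an orthomorphism.
  The initial (0, 0) rules out zero values, and for odd maps distinct squares express
  injectivity.\<close>

definition quadratic_mates :: "int \<Rightarrow> int \<Rightarrow> int \<Rightarrow> (int \<times> int) list \<Rightarrow> (int \<times> int) list \<Rightarrow> (int \<times> int) list \<Rightarrow> bool" where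
  "quadratic_mates p d e xs ys us =
     (if fresh_residues p d e us [(0, 0)] then
        if fresh_residues p d e (ext_minus_lists p us (xs @ ys)) [(0, 0)]
        then mates_satisfy p d e True (elements p True (xs @ ys)) (quadratic_values p d e xs ys) (xs @ ys) us
        else True
      else True)"

fun quadratic_row_check :: "int \<Rightarrow> int \<Rightarrow> int \<Rightarrow> (int \<times> int) list \<Rightarrow> (int \<times> int) list \<Rightarrow> int \<times> int \<Rightarrow>
    (int \<times> int) list \<Rightarrow> bool" where
  "quadratic_row_check p d e xs ys m [] = True"
| "quadratic_row_check p d e xs ys m (m' # ms) =
     (if m = m' then quadratic_row_check p d e xs ys m ms
      else if quadratic_mates p d e xs ys (scale p d e m xs @ scale p d e m' ys)
      then quadratic_row_check p d e xs ys m ms else False)"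

fun quadratic_check :: "int \<Rightarrow> int \<Rightarrow> int \<Rightarrow> (int \<times> int) list \<Rightarrow> (int \<times> int) list \<Rightarrow>
    (int \<times> int) list \<Rightarrow> (int \<times> int) list \<Rightarrow> bool" where
  "quadratic_check p d e xs ys [] cs = True"
| "quadratic_check p d e xs ys (m # ms) cs =
     (if quadratic_row_check p d e xs ys m cs then quadratic_check p d e xs ys ms cs else False)"

fun all_powers :: "int \<Rightarrow> int \<Rightarrow> int \<Rightarrow> int \<Rightarrow> int \<times> int \<Rightarrow> (int \<times> int) list \<Rightarrow> bool" where
  "all_powers p d e n v [] = True"
| "all_powers p d e n v (x # xs) = (if ext_power p d e x n = v then all_powers p d e n v xs else False)"

lemma fresh_iff: "fresh v ws \<longleftrightarrow> v \<notin> set ws"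
  by (induction ws) auto

text \<open>The search visits every choice \<open>picks\<close> of one entry per list without a
  repeated code. An exhausted list is a dead end, where nothing is left to prove.\<close>

lemma backtrack_sound:
  assumes "backtrack P ess A B C ts"
    and "list_all2 (\<lambda>x es. x \<in> set es) picks ess"
    and "distinct (map (\<lambda>(t, a, b, c). a) picks @ A)" "distinct (map (\<lambda>(t, a, b, c). b) picks @ B)"
      "distinct (map (\<lambda>(t, a, b, c). c) picks @ C)"
  shows "P (ts @ map fst picks)"
  using assms
proof (induction P ess A B C ts arbitrary: picks rule: backtrack.induct)
  case (3 P t a b c es ess A B C ts)
  obtain x picks' where picks: "picks = x # picks'" "x \<in> set ((t, a, b, c) # es)"
    "list_all2 (\<lambda>x es. x \<in> set es) picks' ess"
    using "3.prems"(2) by (auto simp: list_all2_Cons2)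
  show ?case
  proof (cases "x = (t, a, b, c)")
    case True
    then have fr: "fresh a A" "fresh b B" "fresh c C"
      using "3.prems"(3-5) picks(1) by (auto simp: fresh_iff)
    then have "backtrack P ess (a # A) (b # B) (c # C) (ts @ [t])"
      using "3.prems"(1) by (auto split: if_splits)
    then have "P ((ts @ [t]) @ map fst picks')"
      using fr picks True "3.prems"(3-5) by (intro "3.IH"(1)) auto
    then show ?thesis using True picks(1) by simp
  next
    case False
    then have l: "list_all2 (\<lambda>x es. x \<in> set es) picks (es # ess)" using picks by auto
    have r: "backtrack P (es # ess) A B C ts" using "3.prems"(1) by (auto split: if_splits)
    show ?thesis
      using "3.IH"(2-5) "3.prems"(1,3-5) l r by (cases "fresh a A"; cases "fresh b B"; cases "fresh c C")
        (auto split: if_splits)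
  qed
qed (auto simp: list_all2_Cons2)

section \<open>Soundness of the search\<close>

context
  fixes p d e :: int and \<alpha> :: "'a::{field,finite}"
  assumes char: "of_int p = (0::'a)" and root: "\<alpha> * \<alpha> = of_int d + of_int e * \<alpha>"
    and p_pos: "p > 0"
begin

lemma pack_mod_inject:
  "pack p (x mod p, y mod p) = pack p (x' mod p, y' mod p) \<Longrightarrow> x mod p = x' mod p \<and> y mod p = y' mod p"
proof -
  assume eq: "pack p (x mod p, y mod p) = pack p (x' mod p, y' mod p)"
  have "(x mod p + p * (y mod p)) mod p = (x' mod p + p * (y' mod p)) mod p"
    using eq by simp
  then have "x mod p = x' mod p" by simp
  then show ?thesis using eq p_pos by simp
qed

lemma residue_code_eqD:
  assumes "residue_code p d e sg v = residue_code p d e sg w"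
  shows "ext_value \<alpha> v = ext_value \<alpha> w \<or> sg \<and> ext_value \<alpha> v = - ext_value \<alpha> w"
proof (cases sg)
  case True
  obtain x y x' y' where vw: "v = (x, y)" "w = (x', y')" by (cases v; cases w) auto
  have "ext_square p d e v = ext_square p d e w"
    using assms pack_mod_inject True
    unfolding vw residue_code_def ext_square.simps by (simp del: pack.simps)
  then have "ext_value \<alpha> v * ext_value \<alpha> v = ext_value \<alpha> w * ext_value \<alpha> w"
    by (simp flip: ext_value_square[OF char root])
  then show ?thesis using True by (simp add: square_eq_iff)
next
  case False
  obtain x y x' y' where vw: "v = (x, y)" "w = (x', y')" by (cases v; cases w) auto
  have "ext_minus p v (0, 0) = ext_minus p w (0, 0)"
    using pack_mod_inject[of "x - 0" "y - 0" "x' - 0" "y' - 0"] assms False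
    by (simp add: vw residue_code_def del: pack.simps)
  then have "ext_value \<alpha> v - ext_value \<alpha> (0, 0) = ext_value \<alpha> w - ext_value \<alpha> (0, 0)"
    by (simp flip: ext_value_minus[OF char root])
  then show ?thesis by simp
qed

lemma ext_value_zeros: "map (ext_value \<alpha>) (zeros xs) = map (\<lambda>_. 0) xs"
  by (induction xs) (simp_all add: ext_value_def)

lemma ext_value_negatives:
  "map (ext_value \<alpha>) (ext_minus_lists p (zeros xs) xs) = map (\<lambda>x. - ext_value \<alpha> x) xs"
  by (induction xs) (simp_all add: ext_value_minus[OF char root], simp add: ext_value_def)

lemma set_elements:
  "ext_value \<alpha> ` set (elements p sg xs) =
    insert 0 (ext_value \<alpha> ` set xs \<union> (if sg then uminus ` ext_value \<alpha> ` set xs else {}))"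
proof -
  have "ext_value \<alpha> ` set (ext_minus_lists p (zeros xs) xs) = uminus ` ext_value \<alpha> ` set xs"
    using arg_cong[OF ext_value_negatives[of xs], of set] by (simp add: image_image)
  then show ?thesis by (auto simp: elements_def ext_value_def image_Un)
qed

definition representatives :: "bool \<Rightarrow> (int \<times> int) list \<Rightarrow> bool" where
  "representatives sg xs \<longleftrightarrow> distinct (map (ext_value \<alpha>) xs) \<and> 0 \<notin> ext_value \<alpha> ` set xs \<and>
     (sg \<longrightarrow> (\<forall>x\<in>set xs. \<forall>y\<in>set xs. ext_value \<alpha> x \<noteq> - ext_value \<alpha> y)) \<and>
     ext_value \<alpha> ` set (elements p sg xs) = UNIV"

text \<open>Pairwise distinct values, as many as the field has elements, exhaust the field; the
  remaining properties are instances of distinctness.\<close>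

lemma representativesI:
  assumes "ext_nonzero p d e q (ext_differences p (elements p sg xs))" "q \<ge> 2"
    and "length (elements p sg xs) = CARD('a)"
  shows "representatives sg xs"
proof -
  have dist: "distinct (map (ext_value \<alpha>) (elements p sg xs))"
    using ext_nonzero_imp[OF char root assms(1,2)] by (rule distinct_if_differences_nonzero[OF char root])
  then have "card (ext_value \<alpha> ` set (elements p sg xs)) = CARD('a)"
    using distinct_card[OF dist] assms(3) by simp
  then have "ext_value \<alpha> ` set (elements p sg xs) = UNIV" by (metis card_subset_eq finite subset_UNIV)
  moreover have "distinct (map (ext_value \<alpha>) xs)" "0 \<notin> ext_value \<alpha> ` set xs"
    using dist by (auto simp: elements_def ext_value_def)
  moreover have "ext_value \<alpha> x \<noteq> - ext_value \<alpha> y" if "sg" "x \<in> set xs" "y \<in> set xs" for x y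
  proof -
    have "distinct (map (ext_value \<alpha>) xs @ map (\<lambda>x. - ext_value \<alpha> x) xs)"
      using dist that(1) by (simp add: elements_def ext_value_negatives)
    then show ?thesis using that(2,3) by (auto simp: image_iff)
  qed
  ultimately show ?thesis by (simp add: representatives_def)
qed

text \<open>Equal codes mean \<phi> x = \<phi> y or, as \<phi> is then odd, \<phi> x = \<phi> (- y).
  Injectivity gives x = y or x = - y, and different representatives allow neither.\<close>

lemma distinct_residue_codes:
  assumes xs: "representatives sg xs" and vs: "map (ext_value \<alpha>) vs = map \<phi> (map (ext_value \<alpha>) xs)"
    and \<phi>: "inj \<phi>" "sg \<Longrightarrow> \<forall>x. \<phi> (- x) = - \<phi> x"
    and code: "\<And>v w. code v = code w \<Longrightarrow>
      ext_value \<alpha> v = ext_value \<alpha> w \<or> sg \<and> ext_value \<alpha> v = - ext_value \<alpha> w"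
  shows "distinct (map code vs)"
  unfolding distinct_conv_nth
proof (intro allI impI)
  fix i j assume ij: "i < length (map code vs)" "j < length (map code vs)" "i \<noteq> j"
  have len: "length vs = length xs" using map_eq_imp_length_eq[OF vs] by simp
  have nth: "ext_value \<alpha> (vs ! k) = \<phi> (ext_value \<alpha> (xs ! k))" if "k < length vs" for k
    using arg_cong[OF vs, of "\<lambda>l. l ! k"] that len by simp
  have ne: "ext_value \<alpha> (xs ! i) \<noteq> ext_value \<alpha> (xs ! j)"
    using xs ij len by (auto simp: representatives_def distinct_conv_nth)
  have ne': "ext_value \<alpha> (xs ! i) \<noteq> - ext_value \<alpha> (xs ! j)" if sg
    using xs ij len that by (auto simp: representatives_def)
  show "map code vs ! i \<noteq> map code vs ! j"
  proof
    assume "map code vs ! i = map code vs ! j"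
    then have "code (vs ! i) = code (vs ! j)" using ij by simp
    from code[OF this] show False
    proof
      assume "ext_value \<alpha> (vs ! i) = ext_value \<alpha> (vs ! j)"
      then show False using nth ij ne \<phi>(1) by (auto dest: injD)
    next
      assume neg: "sg \<and> ext_value \<alpha> (vs ! i) = - ext_value \<alpha> (vs ! j)"
      then have "\<phi> (ext_value \<alpha> (xs ! i)) = \<phi> (- ext_value \<alpha> (xs ! j))"
        using nth ij \<phi>(2) by simp
      then show False using ne' neg \<phi>(1) by (auto dest: injD)
    qed
  qed
qed

text \<open>The values of \<theta> at \<open>xs\<close>, named by candidates, select one entry from
  each list with all codes distinct, and \<open>backtrack_sound\<close> covers every such
  selection.\<close>

lemma mates_satisfy_sound:
  fixes \<theta> \<psi> :: "'a \<Rightarrow> 'a"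
  assumes mates: "mates_satisfy p d e sg (elements p sg xs) P xs ss"
    and xs: "representatives sg xs" and ss: "map (ext_value \<alpha>) ss = map \<psi> (map (ext_value \<alpha>) xs)"
    and inj: "inj \<theta>" "inj (\<lambda>x. \<theta> x - x)" "inj (\<lambda>x. \<theta> x - \<psi> x)"
    and zero: "\<theta> 0 = 0" "\<psi> 0 = 0"
    and odd: "sg \<Longrightarrow> \<forall>x. \<theta> (- x) = - \<theta> x" "sg \<Longrightarrow> \<forall>x. \<psi> (- x) = - \<psi> x"
  shows "\<exists>ts. P ts \<and> map (ext_value \<alpha>) ts = map \<theta> (map (ext_value \<alpha>) xs)"
proof -
  let ?ev = "ext_value \<alpha>" and ?cs = "elements p sg xs"
  have "y \<in> ?ev ` set ?cs" for y
    using xs by (simp add: representatives_def)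
  then have "\<forall>y. \<exists>t. t \<in> set ?cs \<and> ?ev t = y" by (metis imageE)
  then obtain code where code: "code y \<in> set ?cs" "?ev (code y) = y" for y by metis
  let ?t = "\<lambda>x. code (\<theta> (?ev x))" and ?r = "residue_code p d e sg"
  let ?ts = "map ?t xs"
  let ?pick = "\<lambda>x s. (?t x, ?r (?t x), ?r (ext_minus p (?t x) x), ?r (ext_minus p (?t x) s))"
  let ?picks = "map2 ?pick xs ss"
  have len: "length ss = length xs" using map_eq_imp_length_eq[OF ss] by simp
  have ts: "map ?ev ?ts = map \<theta> (map ?ev xs)" by (simp add: code)
  have sub: "map ?ev (map2 (ext_minus p) ?ts vs) = map (\<lambda>x. \<theta> x - \<chi> x) (map ?ev xs)"
    if "map ?ev vs = map \<chi> (map ?ev xs)" for vs \<chi>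
    using that
  proof (induction xs arbitrary: vs)
    case (Cons x xs)
    then show ?case by (cases vs) (auto simp: ext_value_minus[OF char root] code)
  qed simp
  have dist: "distinct (map ?r vs)"
    if "map ?ev vs = map \<phi> (map ?ev xs)" "inj \<phi>" "sg \<Longrightarrow> \<forall>x. \<phi> (- x) = - \<phi> x" for vs \<phi>
    by (rule distinct_residue_codes[OF xs that]) (auto dest: residue_code_eqD)
  have "list_all2 (\<lambda>x es. x \<in> set es) (map2 ?pick xs' ss') (entry_lists p d e sg ?cs xs' ss')"
    if "length ss' = length xs'" "map ?ev ss' = map \<psi> (map ?ev xs')" "0 \<notin> ?ev ` set xs'" for xs' ss'
    using that
  proof (induction ss' xs' rule: list_induct2)
    case (Cons s ss' x xs')
    have x: "?ev x \<noteq> 0" "?ev s = \<psi> (?ev x)" using Cons.prems by auto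
    have ne0: "\<theta> (?ev x) \<noteq> 0" using x(1) zero inj(1) by (metis injD)
    have nex: "\<theta> (?ev x) \<noteq> ?ev x" using x(1) zero injD[OF inj(2), of "?ev x" 0] by auto
    have nes: "\<theta> (?ev x) \<noteq> \<psi> (?ev x)" using x(1) zero injD[OF inj(3), of "?ev x" 0] by auto
    have t: "?t x \<noteq> (0, 0)" "?t x \<noteq> x" "?t x \<noteq> s"
      using ne0 nex nes x(2) code(2)[of "\<theta> (?ev x)"] by (auto simp: ext_value_def)
    have entry: "(t, ?r t, ?r (ext_minus p t x), ?r (ext_minus p t s)) \<in> set (entries p d e sg x s cs)"
      if "t \<in> set cs" "t \<noteq> (0, 0)" "t \<noteq> x" "t \<noteq> s" for t cs
      using that by (induction cs) auto
    show ?case using Cons.IH Cons.prems entry[OF code(1) t] by simp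
  qed simp
  then have "list_all2 (\<lambda>x es. x \<in> set es) ?picks (entry_lists p d e sg ?cs xs ss)"
    using len ss xs by (simp add: representatives_def)
  moreover have "map (\<lambda>(t, a, b, c). a) ?picks = map ?r ?ts"
    "map (\<lambda>(t, a, b, c). b) ?picks = map ?r (map2 (ext_minus p) ?ts xs)"
    "map (\<lambda>(t, a, b, c). c) ?picks = map ?r (map2 (ext_minus p) ?ts ss)" "map fst ?picks = ?ts"
    using len by (auto simp: list_eq_iff_nth_eq)
  moreover have "distinct (map ?r ?ts)" by (rule dist[OF ts]) (use inj odd in auto)
  moreover have "distinct (map ?r (map2 (ext_minus p) ?ts xs))"
    by (rule dist[OF sub[where \<chi> = "\<lambda>x. x"]]) (use inj odd in auto)
  moreover have "distinct (map ?r (map2 (ext_minus p) ?ts ss))"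
    by (rule dist[OF sub[OF ss]]) (use inj odd in auto)
  ultimately have "P ?ts"
    using backtrack_sound[OF mates[unfolded mates_satisfy_def], of ?picks] by simp
  then show ?thesis using ts by blast
qed

lemma same_ratio_sound:
  assumes "same_ratio p d e x t ys us" "map (ext_value \<alpha>) us = map \<theta> (map (ext_value \<alpha>) ys)"
    and "ext_value \<alpha> t = \<theta> (ext_value \<alpha> x)" "y \<in> set ys"
  shows "\<theta> (ext_value \<alpha> x) * ext_value \<alpha> y = \<theta> (ext_value \<alpha> y) * ext_value \<alpha> x"
  using assms
proof (induction ys arbitrary: us)
  case (Cons z ys)
  then obtain u us' where us: "us = u # us'" by (cases us) auto
  then have "ext_mult p d e t z = ext_mult p d e u x" "same_ratio p d e x t ys us'"
    using Cons.prems(1) by (auto split: if_splits)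
  moreover from this(1) have "ext_value \<alpha> t * ext_value \<alpha> z = ext_value \<alpha> u * ext_value \<alpha> x"
    by (metis ext_value_mult[OF char root])
  ultimately show ?case using Cons us by auto
qed simp

lemma proportional_sound:
  assumes "proportional p d e xs us" "map (ext_value \<alpha>) us = map \<theta> (map (ext_value \<alpha>) xs)"
    and "0 \<notin> ext_value \<alpha> ` set xs"
  shows "\<exists>k. \<forall>x\<in>set xs. \<theta> (ext_value \<alpha> x) = k * ext_value \<alpha> x"
proof (cases xs)
  case (Cons x xs')
  then obtain u us' where us: "us = u # us'" using assms(2) by (cases us) auto
  have "\<theta> (ext_value \<alpha> x) * ext_value \<alpha> y = \<theta> (ext_value \<alpha> y) * ext_value \<alpha> x" if "y \<in> set xs'" for y
    using assms(1,2) Cons us that by (intro same_ratio_sound) auto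
  then show ?thesis using assms(3) Cons
    by (intro exI[of _ "\<theta> (ext_value \<alpha> x) / ext_value \<alpha> x"]) (auto simp: field_simps)
qed simp

lemma linear_if_proportional:
  assumes xs: "representatives sg xs" and "\<forall>x\<in>set xs. \<theta> (ext_value \<alpha> x) = k * ext_value \<alpha> x"
    and "\<theta> 0 = 0" "sg \<Longrightarrow> \<forall>x. \<theta> (- x) = - \<theta> x"
  shows "\<theta> y = k * y"
proof -
  have "y \<in> ext_value \<alpha> ` set (elements p sg xs)" using xs by (simp add: representatives_def)
  then show ?thesis using assms unfolding set_elements by (auto split: if_splits)
qed

lemma no_nonlinear_pair_sound:
  fixes \<theta> \<theta>' :: "'a \<Rightarrow> 'a"
  assumes check: "no_nonlinear_pair p d e xs" and xs: "representatives False xs"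
    and orth: "orthogonal_orthomorphisms \<theta> \<theta>'" and zero: "\<theta> 0 = 0" "\<theta>' 0 = 0"
  shows "(\<exists>k. \<forall>y. \<theta> y = k * y) \<or> (\<exists>k. \<forall>y. \<theta>' y = k * y)"
proof -
  have inj: "inj \<theta>" "inj (\<lambda>x. \<theta> x - x)" "inj \<theta>'" "inj (\<lambda>x. \<theta>' x - x)" "inj (\<lambda>x. \<theta> x - \<theta>' x)"
    using orth by (auto simp: orthogonal_orthomorphisms_def orthomorphism_def bij_is_inj)
  have inj': "inj (\<lambda>x. \<theta>' x - \<theta> x)"
    using inj(5) unfolding inj_def by (metis minus_diff_eq)
  have nz: "0 \<notin> ext_value \<alpha> ` set xs" using xs by (simp add: representatives_def)
  obtain us where us: "linear_or_linear_mates p d e xs us"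
    "map (ext_value \<alpha>) us = map \<theta> (map (ext_value \<alpha>) xs)"
    using mates_satisfy_sound[OF check[unfolded no_nonlinear_pair_def] xs, of "\<lambda>_. 0" \<theta>] inj zero
    by (auto simp: ext_value_zeros o_def)
  show ?thesis
  proof (cases "proportional p d e xs us")
    case True
    then obtain k where "\<forall>x\<in>set xs. \<theta> (ext_value \<alpha> x) = k * ext_value \<alpha> x"
      using proportional_sound us(2) nz by blast
    then show ?thesis using linear_if_proportional[OF xs] zero by blast
  next
    case False
    then have "mates_satisfy p d e False (elements p False xs) (proportional p d e xs) xs us"
      using us(1) by (simp add: linear_or_linear_mates_def)
    then obtain vs where "proportional p d e xs vs" "map (ext_value \<alpha>) vs = map \<theta>' (map (ext_value \<alpha>) xs)"
      using mates_satisfy_sound[OF _ xs us(2), of _ \<theta>'] inj inj' zero by blast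
    then obtain k where "\<forall>x\<in>set xs. \<theta>' (ext_value \<alpha> x) = k * ext_value \<alpha> x"
      using proportional_sound nz by blast
    then show ?thesis using linear_if_proportional[OF xs] zero by blast
  qed
qed

lemma quadratic_row_checkD:
  "quadratic_row_check p d e xs ys m cs \<Longrightarrow> m' \<in> set cs \<Longrightarrow> m \<noteq> m' \<Longrightarrow>
    quadratic_mates p d e xs ys (scale p d e m xs @ scale p d e m' ys)"
  by (induction cs) (auto split: if_splits)

lemma quadratic_checkD:
  "quadratic_check p d e xs ys ms cs \<Longrightarrow> m \<in> set ms \<Longrightarrow> quadratic_row_check p d e xs ys m cs"
  by (induction ms) (auto split: if_splits)

lemma ext_value_scale:
  "map (ext_value \<alpha>) (scale p d e m xs) = map (\<lambda>x. ext_value \<alpha> m * x) (map (ext_value \<alpha>) xs)"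
  by (induction xs) (simp_all add: ext_value_mult[OF char root])

lemma fresh_residuesI:
  "distinct (map (ext_square p d e) vs @ A) \<Longrightarrow> fresh_residues p d e vs A"
  by (induction vs arbitrary: A) (auto simp: fresh_iff)

lemma quadratic_check_sound:
  fixes \<theta> \<theta>' :: "'a \<Rightarrow> 'a"
  assumes check: "quadratic_check p d e xs ys (elements p True (xs @ ys)) (elements p True (xs @ ys))"
    and xs: "representatives True (xs @ ys)"
    and orth: "orthogonal_orthomorphisms \<theta> \<theta>'" and zero: "\<theta> 0 = 0" "\<theta>' 0 = 0"
    and odd: "\<forall>x. \<theta> (- x) = - \<theta> x" "\<forall>x. \<theta>' (- x) = - \<theta>' x"
    and m: "\<forall>x\<in>set xs. \<theta> (ext_value \<alpha> x) = m * ext_value \<alpha> x"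
      "\<forall>x\<in>set ys. \<theta> (ext_value \<alpha> x) = m' * ext_value \<alpha> x"
  shows "(\<exists>k. \<forall>y. \<theta> y = k * y) \<or>
    (\<exists>k k'. (\<forall>x\<in>set xs. \<theta>' (ext_value \<alpha> x) = k * ext_value \<alpha> x) \<and>
      (\<forall>x\<in>set ys. \<theta>' (ext_value \<alpha> x) = k' * ext_value \<alpha> x))"
proof -
  let ?ev = "ext_value \<alpha>"
  have inj: "inj \<theta>" "inj (\<lambda>x. \<theta> x - x)" "inj \<theta>'" "inj (\<lambda>x. \<theta>' x - x)" "inj (\<lambda>x. \<theta> x - \<theta>' x)"
    using orth by (auto simp: orthogonal_orthomorphisms_def orthomorphism_def bij_is_inj)
  have inj': "inj (\<lambda>x. \<theta>' x - \<theta> x)"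
    using inj(5) unfolding inj_def by (metis minus_diff_eq)
  have nz: "0 \<notin> ?ev ` set (xs @ ys)" using xs by (simp add: representatives_def)
  obtain c c' where c: "c \<in> set (elements p True (xs @ ys))" "?ev c = m"
    "c' \<in> set (elements p True (xs @ ys))" "?ev c' = m'"
  proof -
    have "m \<in> ?ev ` set (elements p True (xs @ ys))" "m' \<in> ?ev ` set (elements p True (xs @ ys))"
      using xs by (simp_all add: representatives_def)
    then show ?thesis using that by auto
  qed
  show ?thesis
  \<comment> \<open>The check skips equal multipliers, for which \<theta> is linear.\<close>
  proof (cases "c = c'")
    case True
    then have "\<forall>x\<in>set (xs @ ys). \<theta> (?ev x) = m * ?ev x" using c m by auto
    then have "\<forall>y. \<theta> y = m * y" using linear_if_proportional[OF xs] zero odd by blast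
    then show ?thesis by blast
  next
    case False
    let ?us = "scale p d e c xs @ scale p d e c' ys"
    have us: "map ?ev ?us = map \<theta> (map ?ev (xs @ ys))"
      using c m by (simp add: ext_value_scale)
    have len: "length ?us = length (xs @ ys)" using map_eq_imp_length_eq[OF us] by simp
    have dif: "map ?ev (ext_minus_lists p ?us (xs @ ys)) = map (\<lambda>x. \<theta> x - x) (map ?ev (xs @ ys))"
    proof -
      have "map2 (-) (map \<theta> zs) zs = map (\<lambda>x. \<theta> x - x) zs" for zs by (induction zs) simp_all
      then show ?thesis unfolding ext_value_minus_lists[OF char root] us .
    qed
    have fr: "fresh_residues p d e vs [(0, 0)]"
      if vs: "map ?ev vs = map \<phi> (map ?ev (xs @ ys))" and \<phi>: "inj \<phi>" "\<forall>x. \<phi> (- x) = - \<phi> x" "\<phi> 0 = 0" for vs \<phi>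
    proof (rule fresh_residuesI)
      have sq: "?ev v = ?ev w \<or> True \<and> ?ev v = - ?ev w" if "ext_square p d e v = ext_square p d e w" for v w
        using arg_cong[OF that, of ?ev] by (simp add: ext_value_square[OF char root] square_eq_iff)
      have "distinct (map (ext_square p d e) vs)"
        using \<phi> by (intro distinct_residue_codes[OF xs vs] sq) auto
      moreover have "(0, 0) \<noteq> ext_square p d e v" if "v \<in> set vs" for v
      proof
        assume "(0, 0) = ext_square p d e v"
        then have "?ev v * ?ev v = ?ev (0, 0)" by (metis ext_value_square[OF char root])
        then have v0: "?ev v = 0" by (simp add: ext_value_def)
        have "?ev v \<in> set (map \<phi> (map ?ev (xs @ ys)))"
          unfolding vs[symmetric] using that by simp
        then obtain x where "x \<in> ?ev ` set (xs @ ys)" "?ev v = \<phi> x" by auto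
        then show False using nz \<phi>(3) v0 injD[OF \<phi>(1), of x 0] by metis
      qed
      ultimately show "distinct (map (ext_square p d e) vs @ [(0, 0)])" by auto
    qed
    have "quadratic_mates p d e xs ys ?us"
      using quadratic_row_checkD[OF quadratic_checkD[OF check c(1)] c(3) False] .
    moreover have "fresh_residues p d e ?us [(0, 0)]" using inj zero odd by (intro fr[OF us]) auto
    moreover have "fresh_residues p d e (ext_minus_lists p ?us (xs @ ys)) [(0, 0)]"
      using inj zero odd by (intro fr[OF dif]) auto
    ultimately have "mates_satisfy p d e True (elements p True (xs @ ys)) (quadratic_values p d e xs ys) (xs @ ys) ?us"
      by (simp add: quadratic_mates_def)
    then obtain vs where vs: "quadratic_values p d e xs ys vs" "map ?ev vs = map \<theta>' (map ?ev (xs @ ys))"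
      using mates_satisfy_sound[OF _ xs us, of _ \<theta>'] inj inj' zero odd by blast
    have "map ?ev (take (length xs) vs) = map \<theta>' (map ?ev xs)" "map ?ev (drop (length xs) vs) = map \<theta>' (map ?ev ys)"
      using vs(2) by (simp_all flip: take_map drop_map)
    then show ?thesis
      using vs(1) proportional_sound nz by (auto simp: quadratic_values_def image_Un split: if_splits)
  qed
qed

lemma all_powersD:
  "all_powers p d e (int n) v xs \<Longrightarrow> n > 0 \<Longrightarrow> x \<in> set xs \<Longrightarrow> ext_value \<alpha> x ^ n = ext_value \<alpha> v"
proof (induction xs)
  case (Cons y ys)
  have "ext_value \<alpha> (ext_power p d e y (int n)) = ext_value \<alpha> y ^ n"
    using Cons.prems(2) ext_value_power[OF char root, of "int n" y] by simp
  then show ?case using Cons by (auto split: if_splits)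
qed simp

text \<open>Since M is even, x and -x have the same M-th power. It is 1 on \<open>xs\<close> and -1,
  encoded as p - 1, on \<open>ys\<close>, so these lists and their negatives are the two
  classes.\<close>

lemma quadratic_index_map:
  assumes xs: "representatives True (xs @ ys)" and M: "even M" "M > 0"
    and pow: "all_powers p d e (int M) (1, 0) xs" "all_powers p d e (int M) (p - 1, 0) ys"
    and two: "(1::'a) \<noteq> -1"
    and \<theta>: "\<theta> 0 = 0" "\<forall>x. \<theta> (- x) = - \<theta> x"
  shows "index_map M \<theta> \<longleftrightarrow> (\<exists>k k'. (\<forall>x\<in>set xs. \<theta> (ext_value \<alpha> x) = k * ext_value \<alpha> x) \<and>
      (\<forall>x\<in>set ys. \<theta> (ext_value \<alpha> x) = k' * ext_value \<alpha> x))"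
proof
  let ?ev = "ext_value \<alpha>"
  have p1: "x \<in> set xs \<Longrightarrow> ?ev x ^ M = 1" for x using all_powersD[OF pow(1) M(2)] by (simp add: ext_value_def)
  have p2: "x \<in> set ys \<Longrightarrow> ?ev x ^ M = -1" for x using all_powersD[OF pow(2) M(2)] by (simp add: ext_value_def char)
  have nz: "x \<in> set (xs @ ys) \<Longrightarrow> ?ev x \<noteq> 0" for x using xs by (auto simp: representatives_def)
  have ratio: "\<exists>k. \<forall>x\<in>set zs. \<theta> (?ev x) = k * ?ev x"
    if ind: "index_map M \<theta>" and zs: "\<forall>x\<in>set zs. ?ev x ^ M = c" "set zs \<subseteq> set (xs @ ys)" for zs c
  proof (cases zs)
    case (Cons z zs')
    have "\<theta> (?ev x) * ?ev z = \<theta> (?ev z) * ?ev x" if "x \<in> set zs" for x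
    proof -
      have "z \<in> set zs" using Cons by simp
      then have "x \<in> set (xs @ ys)" "z \<in> set (xs @ ys)" "?ev x ^ M = ?ev z ^ M" using that zs by auto
      then have "?ev x \<noteq> 0" "?ev z \<noteq> 0" "?ev x ^ M = ?ev z ^ M" using nz by blast+
      then show ?thesis using ind unfolding index_map_def by blast
    qed
    moreover have "?ev z \<noteq> 0" using nz zs(2) Cons by auto
    ultimately show ?thesis
      by (intro exI[of _ "\<theta> (?ev z) / ?ev z"]) (simp add: field_simps)
  qed simp
  show "index_map M \<theta> \<Longrightarrow> \<exists>k k'. (\<forall>x\<in>set xs. \<theta> (?ev x) = k * ?ev x) \<and> (\<forall>x\<in>set ys. \<theta> (?ev x) = k' * ?ev x)"
    using ratio[of xs 1] ratio[of ys "-1"] p1 p2 by auto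
  assume "\<exists>k k'. (\<forall>x\<in>set xs. \<theta> (?ev x) = k * ?ev x) \<and> (\<forall>x\<in>set ys. \<theta> (?ev x) = k' * ?ev x)"
  then obtain k k' where k: "\<forall>x\<in>set xs. \<theta> (?ev x) = k * ?ev x" "\<forall>x\<in>set ys. \<theta> (?ev x) = k' * ?ev x"
    by blast
  have val: "\<theta> y = (if y ^ M = 1 then k else k') * y" if "y \<noteq> 0" for y
  proof -
    have "y \<in> ?ev ` set (elements p True (xs @ ys))" using xs by (simp add: representatives_def)
    then show ?thesis using that k p1 p2 two \<theta> M unfolding set_elements by auto
  qed
  show "index_map M \<theta>"
    unfolding index_map_def using val \<theta>(1) by simp
qed

end

section \<open>Search results for q = 3, 4, 5, 7, 9, 13\<close>

lemma no_nonlinear_pair_3: "no_nonlinear_pair 3 0 0 [(1, 0), (2, 0)]"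
  by code_simp

lemma distinct_elements_3:
  "ext_nonzero 3 0 0 3 (ext_differences 3 (elements 3 False [(1, 0), (2, 0)]))"
  by code_simp

lemma no_nonlinear_pair_4: "no_nonlinear_pair 2 1 1 [(1, 0), (0, 1), (1, 1)]"
  by code_simp

lemma distinct_elements_4:
  "ext_nonzero 2 1 1 4 (ext_differences 2 (elements 2 False [(1, 0), (0, 1), (1, 1)]))"
  by code_simp

lemma no_nonlinear_pair_5: "no_nonlinear_pair 5 0 0 [(1, 0), (2, 0), (3, 0), (4, 0)]"
  by code_simp

lemma distinct_elements_5:
  "ext_nonzero 5 0 0 5 (ext_differences 5 (elements 5 False [(1, 0), (2, 0), (3, 0), (4, 0)]))"
  by code_simp

lemma no_nonlinear_pair_7: "no_nonlinear_pair 7 0 0 [(1, 0), (2, 0), (3, 0), (4, 0), (5, 0), (6, 0)]"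
  by code_simp

lemma distinct_elements_7:
  "ext_nonzero 7 0 0 7 (ext_differences 7 (elements 7 False [(1, 0), (2, 0), (3, 0), (4, 0), (5, 0), (6, 0)]))"
  by code_simp

text \<open>Up to sign, 1 and \<alpha> are the squares and 1 + \<alpha>, 1 + 2 \<alpha> the
  nonsquares; \<open>quadratic_characters_9\<close> confirms this.\<close>

lemma quadratic_check_9: "quadratic_check 3 2 0 [(1, 0), (0, 1)] [(1, 1), (1, 2)]
    (elements 3 True ([(1, 0), (0, 1)] @ [(1, 1), (1, 2)]))
    (elements 3 True ([(1, 0), (0, 1)] @ [(1, 1), (1, 2)]))"
  by code_simp

lemma distinct_elements_9:
  "ext_nonzero 3 2 0 9 (ext_differences 3 (elements 3 True ([(1, 0), (0, 1)] @ [(1, 1), (1, 2)])))"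
  by code_simp

lemma quadratic_characters_9: "all_powers 3 2 0 4 (1, 0) [(1, 0), (0, 1)]"
    "all_powers 3 2 0 4 (2, 0) [(1, 1), (1, 2)]"
  by code_simp+

lemma quadratic_check_13: "quadratic_check 13 0 0 [(1, 0), (3, 0), (4, 0)] [(2, 0), (5, 0), (6, 0)]
    (elements 13 True ([(1, 0), (3, 0), (4, 0)] @ [(2, 0), (5, 0), (6, 0)]))
    (elements 13 True ([(1, 0), (3, 0), (4, 0)] @ [(2, 0), (5, 0), (6, 0)]))"
  by code_simp

lemma distinct_elements_13:
  "ext_nonzero 13 0 0 13 (ext_differences 13 (elements 13 True ([(1, 0), (3, 0), (4, 0)] @ [(2, 0), (5, 0), (6, 0)])))"
  by code_simp

lemma quadratic_characters_13: "all_powers 13 0 0 6 (1, 0) [(1, 0), (3, 0), (4, 0)]"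
    "all_powers 13 0 0 6 (12, 0) [(2, 0), (5, 0), (6, 0)]"
  by code_simp+

section \<open>Prime powers below 361\<close>

definition has_small_divisor :: "int \<Rightarrow> bool" where
  "has_small_divisor q =
     (if q mod 2 = 0 then True else if q mod 3 = 0 then True else if q mod 5 = 0 then True
      else if q mod 7 = 0 then True else if q mod 11 = 0 then True else if q mod 13 = 0 then True
      else q mod 17 = 0)"

primrec remove_small_multiples :: "int list \<Rightarrow> int list" where
  "remove_small_multiples [] = []"
| "remove_small_multiples (q # qs) =
     (if has_small_divisor q then remove_small_multiples qs else q # remove_small_multiples qs)"

lemma small_multiples: "remove_small_multiples [0..360] =
    [1, 19, 23, 29, 31, 37, 41, 43, 47, 53, 59, 61, 67, 71, 73, 79, 83, 89, 97, 101, 103, 107,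
     109, 113, 127, 131, 137, 139, 149, 151, 157, 163, 167, 173, 179, 181, 191, 193, 197, 199,
     211, 223, 227, 229, 233, 239, 241, 251, 257, 263, 269, 271, 277, 281, 283, 293, 307, 311,
     313, 317, 331, 337, 347, 349, 353, 359]"
  by code_simp

section \<open>Existence\<close>

text \<open>Euler's criterion: the exponent (q - 1) / 2 belongs to the whole field, while the power
  of d is computed modulo p.\<close>

lemma obtain_square_root:
  fixes g :: "'a::{field,finite}"
  assumes gen: "field_generator g" and q: "int CARD('a) = q" "even (q - 1)"
    and p: "of_int p = (0::'a)" and d: "d ^ nat ((q - 1) div 2) mod p = 1 mod p"
  obtains \<alpha> :: 'a where "\<alpha> * \<alpha> = of_int d + of_int 0 * \<alpha>"
proof -
  let ?k = "nat ((q - 1) div 2)"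
  have "q - 1 = 2 * ((q - 1) div 2)" using q(2) by simp
  then have k: "?k * 2 = CARD('a) - 1" using q(1) card_field_gt_1[where 'a = 'a] by linarith
  note reduce = of_int_mod_char[of p "0::'a" 0 0, OF p]
  have "of_int d ^ ?k = (of_int (d ^ ?k mod p) :: 'a)" using reduce by simp
  also have "\<dots> = of_int 1" unfolding d using reduce by simp
  finally have "(of_int d :: 'a) ^ ?k = 1" by simp
  then obtain x :: 'a where "x ^ 2 = of_int d" using obtain_power_residue[OF gen k] by metis
  then show ?thesis using that[of x] by (simp add: power2_eq_square)
qed

text \<open>An element of order 3 is a root of x^2 + x + 1, and signs do not matter in
  characteristic 2.\<close>

lemma obtain_cube_root_of_unity:
  fixes g :: "'a::{field,finite}"
  assumes gen: "field_generator g" and q: "CARD('a) = 2 ^ n" "3 dvd CARD('a) - 1"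
  obtains \<alpha> :: 'a where "\<alpha> * \<alpha> = of_int 1 + of_int 1 * \<alpha>"
proof -
  obtain m where m: "CARD('a) - 1 = 3 * m" using q(2) by blast
  have "(2::'a) = 0" using card_power_eq_0[OF q(1)] by simp
  then have two: "x + x = 0" for x :: 'a by (metis mult_2 mult_zero_left)
  have "m > 0" using m card_field_gt_1[where 'a = 'a] by (cases m) auto
  then have "\<not> 3 * m dvd m" by (auto dest: dvd_imp_le)
  then have "g ^ m \<noteq> g ^ 0" unfolding generator_power_eq_iff[OF gen] m cong_0_iff .
  moreover have "(g ^ m) ^ 3 = 1"
    using power_residue_root[OF gen, of 3 m g] m generator_nonzero[OF gen] by simp
  moreover have "x ^ 3 - 1 = (x - 1) * (x * x + x + 1)" for x :: 'a
    by (simp add: algebra_simps power3_eq_cube)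
  ultimately have "g ^ m * g ^ m + g ^ m + 1 = 0" by (metis diff_self mult_eq_0_iff power_0 right_minus_eq)
  then have "g ^ m * g ^ m = 1 + g ^ m" using two by (metis add.assoc add.commute add_right_cancel)
  then show ?thesis using that[of "g ^ m"] by simp
qed

text \<open>This variant of \<open>ext_pair_check_sound\<close> has integers q and M, so that the
  numerals of the computed checks match.\<close>

lemma ext_pair_exists:
  fixes g \<alpha> :: "'a::{field,finite}"
  assumes gen: "field_generator g" and check: "ext_pair_check p d e q a b a' b' M u u' v v'"
    and q: "int CARD('a) = q" and p: "of_int p = (0::'a)" and root: "\<alpha> * \<alpha> = of_int d + of_int e * \<alpha>"
    and c: "int c * M = q - 1" "a * a' = c" "b * b' = c" and ab: "1 < a" "1 < b" "M > 0"
  shows "has_orthogonal_pair g a b"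
proof (rule ext_pair_check_sound[OF gen p root _ c(2,3) ab(1,2)])
  have "int (c * nat M) = int (CARD('a) - 1)"
    using c(1) q ab(3) card_field_gt_1[where 'a = 'a] by simp
  then show "c * nat M = CARD('a) - 1" by (rule of_nat_eq_iff[THEN iffD1])
  show "ext_pair_check p d e (int CARD('a)) a b a' b' (int (nat M)) u u' v v'"
    using check q ab(3) by (simp del: ext_pair_check.simps)
qed

lemma ext_list_exists:
  fixes g \<alpha> :: "'a::{field,finite}"
  assumes gen: "field_generator g" and check: "ext_list_check p d e q a' b' M \<zeta> us vs"
    and q: "int CARD('a) = q" and p: "of_int p = (0::'a)" and root: "\<alpha> * \<alpha> = of_int d + of_int e * \<alpha>"
    and c: "int c * M = q - 1" "a * a' = c" "b * b' = c" and len: "length us = a" "length vs = b" "M > 0"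
  shows "has_orthogonal_pair g a b"
proof (rule ext_list_check_sound[OF gen p root _ c(2,3) len(1,2)])
  have "int (c * nat M) = int (CARD('a) - 1)"
    using c(1) q len(3) card_field_gt_1[where 'a = 'a] by simp
  then show "c * nat M = CARD('a) - 1" by (rule of_nat_eq_iff[THEN iffD1])
  show "ext_list_check p d e (int CARD('a)) a' b' (int (nat M)) \<zeta> us vs"
    using check q len(3) by (simp del: ext_list_check.simps)
qed

lemma set_remove_small_multiples:
  "set (remove_small_multiples qs) = {q \<in> set qs. \<not> has_small_divisor q}"
  by (induction qs) auto

text \<open>As 361 = 19^2, the sieve by the primes up to 17 leaves only 1 and primes. Every other q
  is a power of one of these seven primes, with exponent at most 8 because 2^9 > 361.\<close>

lemma primepow_below_361:
  fixes q :: nat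
  assumes "primepow q" "q < 361"
  shows "q \<in> {2, 3, 4, 5, 7, 8, 9, 11, 13, 16, 17, 19, 23, 25, 27, 29, 31, 32, 37, 41, 43, 47, 49, 53,
     59, 61, 64, 67, 71, 73, 79, 81, 83, 89, 97, 101, 103, 107, 109, 113, 121, 125, 127, 128,
     131, 137, 139, 149, 151, 157, 163, 167, 169, 173, 179, 181, 191, 193, 197, 199, 211, 223,
     227, 229, 233, 239, 241, 243, 251, 256, 257, 263, 269, 271, 277, 281, 283, 289, 293, 307,
     311, 313, 317, 331, 337, 343, 347, 349, 353, 359}"
proof -
  obtain p n where pn: "prime p" "n > 0" "q = p ^ n" using assms(1) by (auto simp: primepow_def)
  have "2 ^ n \<le> p ^ n" using prime_ge_2_nat[OF pn(1)] by (intro power_mono) auto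
  then have "2 ^ n < (2 ^ 9 :: nat)" using assms(2) pn(3) by simp
  then have "n < 9" by (rule power_less_imp_less_exp[rotated]) simp
  then have n: "n \<in> {1, 2, 3, 4, 5, 6, 7, 8}" using pn(2) by auto
  show ?thesis
  proof (cases "has_small_divisor (int q)")
    case True
    have "has_small_divisor (int q) \<longleftrightarrow> 2 dvd q \<or> 3 dvd q \<or> 5 dvd q \<or> 7 dvd q \<or> 11 dvd q \<or> 13 dvd q \<or> 17 dvd q"
    proof -
      have "int q mod int r = 0 \<longleftrightarrow> r dvd q" for r
        by (simp add: dvd_eq_mod_eq_0 flip: zmod_int)
      from this[of 2] this[of 3] this[of 5] this[of 7] this[of 11] this[of 13] this[of 17]
      show ?thesis by (simp add: has_small_divisor_def)
    qed
    then obtain r where r: "r \<in> {2, 3, 5, 7, 11, 13, 17}" "r dvd q" using True by blast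
    have "prime r" using r(1) by auto
    then have "r = p" using r(2) pn by (metis prime_dvd_power primes_dvd_imp_eq)
    then have "p \<in> {2, 3, 5, 7, 11, 13, 17}" using r(1) by simp
    then show ?thesis using n assms(2) unfolding pn(3) by (elim insertE emptyE) simp_all
  next
    case False
    then have "int q \<in> set (remove_small_multiples [0..360])"
      using assms(2) by (simp add: set_remove_small_multiples)
    moreover have "q \<noteq> 1" using assms(1) by auto
    ultimately show ?thesis unfolding small_multiples by auto
  qed
qed

section \<open>The nine pairs of indices\<close>

lemma pair_exists_2_2:
  fixes g :: "'a::{field,finite}"
  assumes gen: "field_generator g" and q: "primepow CARD('a)" "[CARD('a) = 1] (mod 2)" "CARD('a) > 7"
  shows "has_orthogonal_pair g 2 2"
proof -
  have dvd: "2 dvd CARD('a) - 1"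
    using q(2) card_field_gt_1[where 'a = 'a] by (simp add: cong_altdef_nat cong_sym_eq)
  then have M: "2 * ((CARD('a) - 1) div 2) = CARD('a) - 1" by simp
  show ?thesis
  \<comment> \<open>12 is the least q with 2^3 + 3 < q, where
    \<open>has_orthogonal_pair_diagonal\<close> takes over; 31, 68, 129 and 220 arise in the same
    way for the indices 3 to 6.\<close>
  proof (cases "CARD('a) < 12")
    case False
    then show ?thesis using has_orthogonal_pair_diagonal[OF gen M] by simp
  next
    case True
    then have "CARD('a) \<in> {11} \<or> CARD('a) \<in> {9}"
    proof -
      have "CARD('a) < 361" using True by simp
      from primepow_below_361[OF q(1) this] show ?thesis
        using q(2-) True by (elim insertE emptyE) (simp_all add: cong_def)
    qed
    then show ?thesis
    proof
      assume "CARD('a) \<in> {11}"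
      then have "int CARD('a) \<in> int ` {11}" by (rule imageI)
      then show ?thesis
        \<comment> \<open>Folding gives the integer numerals of the table the form
          \<open>int 2\<close>, which matches \<open>int c\<close>.\<close>
        using dvd by (intro pair_table_check_sound[OF gen, where c = 2, OF pair_table_2_2[folded of_nat_numeral[where 'a = int]]]) auto
    next
      assume "CARD('a) \<in> {9}"
      then consider "CARD('a) = 9" by auto
      then show ?thesis
      proof cases
        case 1
        then have p: "of_int 3 = (0::'a)" using card_power_eq_0[where 'a = 'a, of 3 2] by simp
        obtain \<alpha> :: 'a where root: "\<alpha> * \<alpha> = of_int 2 + of_int 0 * \<alpha>"
          using obtain_square_root[OF gen, of 9 3 2] p \<open>CARD('a) = 9\<close> by auto
        show ?thesis
          by (rule ext_pair_exists[OF gen ext_pair_2_2_9 _ p root, where c = 2]) (use \<open>CARD('a) = 9\<close> in simp_all)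
      qed
    qed
  qed
qed

lemma pair_exists_3_3:
  fixes g :: "'a::{field,finite}"
  assumes gen: "field_generator g" and q: "primepow CARD('a)" "[CARD('a) = 1] (mod 3)" "CARD('a) > 7"
  shows "has_orthogonal_pair g 3 3"
proof -
  have dvd: "3 dvd CARD('a) - 1"
    using q(2) card_field_gt_1[where 'a = 'a] by (simp add: cong_altdef_nat cong_sym_eq)
  then have M: "3 * ((CARD('a) - 1) div 3) = CARD('a) - 1" by simp
  show ?thesis
  proof (cases "CARD('a) < 31")
    case False
    then show ?thesis using has_orthogonal_pair_diagonal[OF gen M] by simp
  next
    case True
    then have "CARD('a) \<in> {13, 19, 25} \<or> CARD('a) \<in> {16}"
    proof -
      have "CARD('a) < 361" using True by simp
      from primepow_below_361[OF q(1) this] show ?thesis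
        using q(2-) True by (elim insertE emptyE) (simp_all add: cong_def)
    qed
    then show ?thesis
    proof
      assume "CARD('a) \<in> {13, 19, 25}"
      then have "int CARD('a) \<in> int ` {13, 19, 25}" by (rule imageI)
      then show ?thesis
        using dvd by (intro pair_table_check_sound[OF gen, where c = 3, OF pair_table_3_3[folded of_nat_numeral[where 'a = int]]]) auto
    next
      assume "CARD('a) \<in> {16}"
      then consider "CARD('a) = 16" by auto
      then show ?thesis
      proof cases
        case 1
        then show ?thesis by (rule has_orthogonal_pair_16[OF gen])
      qed
    qed
  qed
qed

lemma pair_exists_4_4:
  fixes g :: "'a::{field,finite}"
  assumes gen: "field_generator g" and q: "primepow CARD('a)" "[CARD('a) = 1] (mod 4)" "CARD('a) > 7"
  shows "has_orthogonal_pair g 4 4"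
proof -
  have dvd: "4 dvd CARD('a) - 1"
    using q(2) card_field_gt_1[where 'a = 'a] by (simp add: cong_altdef_nat cong_sym_eq)
  then have M: "4 * ((CARD('a) - 1) div 4) = CARD('a) - 1" by simp
  show ?thesis
  proof (cases "CARD('a) < 68")
    case False
    then show ?thesis using has_orthogonal_pair_diagonal[OF gen M] by simp
  next
    case True
    then have "CARD('a) \<in> {17, 29, 37, 41, 49, 53, 61} \<or> CARD('a) \<in> {9, 13, 25}"
    proof -
      have "CARD('a) < 361" using True by simp
      from primepow_below_361[OF q(1) this] show ?thesis
        using q(2-) True by (elim insertE emptyE) (simp_all add: cong_def)
    qed
    then show ?thesis
    proof
      assume "CARD('a) \<in> {17, 29, 37, 41, 49, 53, 61}"
      then have "int CARD('a) \<in> int ` {17, 29, 37, 41, 49, 53, 61}" by (rule imageI)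
      then show ?thesis
        using dvd by (intro pair_table_check_sound[OF gen, where c = 4, OF pair_table_4_4[folded of_nat_numeral[where 'a = int]]]) auto
    next
      assume "CARD('a) \<in> {9, 13, 25}"
      then consider "CARD('a) = 9" | "CARD('a) = 13" | "CARD('a) = 25" by auto
      then show ?thesis
      proof cases
        case 1
        then have p: "of_int 3 = (0::'a)" using card_power_eq_0[where 'a = 'a, of 3 2] by simp
        obtain \<alpha> :: 'a where root: "\<alpha> * \<alpha> = of_int 2 + of_int 0 * \<alpha>"
          using obtain_square_root[OF gen, of 9 3 2] p \<open>CARD('a) = 9\<close> by auto
        show ?thesis
          by (rule ext_list_exists[OF gen ext_list_4_4_9 _ p root, where c = 4]) (use \<open>CARD('a) = 9\<close> in simp_all)
      next
        case 2
        then have p: "of_int 13 = (0::'a)" using card_power_eq_0[where 'a = 'a, of 13 1] by simp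
        show ?thesis
          by (rule ext_list_exists[OF gen ext_list_4_4_13 _ p, where \<alpha> = 0 and c = 4]) (use \<open>CARD('a) = 13\<close> in simp_all)
      next
        case 3
        then have p: "of_int 5 = (0::'a)" using card_power_eq_0[where 'a = 'a, of 5 2] by simp
        obtain \<alpha> :: 'a where root: "\<alpha> * \<alpha> = of_int 2 + of_int 0 * \<alpha>"
          using obtain_square_root[OF gen, of 25 5 2] p \<open>CARD('a) = 25\<close> by auto
        show ?thesis
          by (rule ext_pair_exists[OF gen ext_pair_4_4_25 _ p root, where c = 4]) (use \<open>CARD('a) = 25\<close> in simp_all)
      qed
    qed
  qed
qed

lemma pair_exists_5_5:
  fixes g :: "'a::{field,finite}"
  assumes gen: "field_generator g" and q: "primepow CARD('a)" "[CARD('a) = 1] (mod 5)" "CARD('a) > 7"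
  shows "has_orthogonal_pair g 5 5"
proof -
  have dvd: "5 dvd CARD('a) - 1"
    using q(2) card_field_gt_1[where 'a = 'a] by (simp add: cong_altdef_nat cong_sym_eq)
  then have M: "5 * ((CARD('a) - 1) div 5) = CARD('a) - 1" by simp
  show ?thesis
  proof (cases "CARD('a) < 129")
    case False
    then show ?thesis using has_orthogonal_pair_diagonal[OF gen M] by simp
  next
    case True
    then have "CARD('a) \<in> {31, 41, 61, 71, 101} \<or> CARD('a) \<in> {11, 16, 81, 121}"
    proof -
      have "CARD('a) < 361" using True by simp
      from primepow_below_361[OF q(1) this] show ?thesis
        using q(2-) True by (elim insertE emptyE) (simp_all add: cong_def)
    qed
    then show ?thesis
    proof
      assume "CARD('a) \<in> {31, 41, 61, 71, 101}"
      then have "int CARD('a) \<in> int ` {31, 41, 61, 71, 101}" by (rule imageI)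
      then show ?thesis
        using dvd by (intro pair_table_check_sound[OF gen, where c = 5, OF pair_table_5_5[folded of_nat_numeral[where 'a = int]]]) auto
    next
      assume "CARD('a) \<in> {11, 16, 81, 121}"
      then consider "CARD('a) = 11" | "CARD('a) = 16" | "CARD('a) = 81" | "CARD('a) = 121" by auto
      then show ?thesis
      proof cases
        case 1
        then have p: "of_int 11 = (0::'a)" using card_power_eq_0[where 'a = 'a, of 11 1] by simp
        show ?thesis
          by (rule ext_list_exists[OF gen ext_list_5_5_11 _ p, where \<alpha> = 0 and c = 5]) (use \<open>CARD('a) = 11\<close> in simp_all)
      next
        case 2
        then have p: "of_int 2 = (0::'a)" using card_power_eq_0[where 'a = 'a, of 2 4] by simp
        obtain \<alpha> :: 'a where root: "\<alpha> * \<alpha> = of_int 1 + of_int 1 * \<alpha>"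
          using obtain_cube_root_of_unity[OF gen, of 4] \<open>CARD('a) = 16\<close> by auto
        show ?thesis
          by (rule ext_pair_exists[OF gen ext_pair_5_5_16 _ p root, where c = 5]) (use \<open>CARD('a) = 16\<close> in simp_all)
      next
        case 3
        then have p: "of_int 3 = (0::'a)" using card_power_eq_0[where 'a = 'a, of 3 4] by simp
        obtain \<alpha> :: 'a where root: "\<alpha> * \<alpha> = of_int 2 + of_int 0 * \<alpha>"
          using obtain_square_root[OF gen, of 81 3 2] p \<open>CARD('a) = 81\<close> by auto
        show ?thesis
          by (rule ext_pair_exists[OF gen ext_pair_5_5_81 _ p root, where c = 5]) (use \<open>CARD('a) = 81\<close> in simp_all)
      next
        case 4
        then have p: "of_int 11 = (0::'a)" using card_power_eq_0[where 'a = 'a, of 11 2] by simp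
        obtain \<alpha> :: 'a where root: "\<alpha> * \<alpha> = of_int 2 + of_int 0 * \<alpha>"
          using obtain_square_root[OF gen, of 121 11 2] p \<open>CARD('a) = 121\<close> by auto
        show ?thesis
          by (rule ext_pair_exists[OF gen ext_pair_5_5_121 _ p root, where c = 5]) (use \<open>CARD('a) = 121\<close> in simp_all)
      qed
    qed
  qed
qed

lemma pair_exists_6_6:
  fixes g :: "'a::{field,finite}"
  assumes gen: "field_generator g" and q: "primepow CARD('a)" "[CARD('a) = 1] (mod 6)" "CARD('a) > 7"
  shows "has_orthogonal_pair g 6 6"
proof -
  have dvd: "6 dvd CARD('a) - 1"
    using q(2) card_field_gt_1[where 'a = 'a] by (simp add: cong_altdef_nat cong_sym_eq)
  then have M: "6 * ((CARD('a) - 1) div 6) = CARD('a) - 1" by simp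
  show ?thesis
  proof (cases "CARD('a) < 220")
    case False
    then show ?thesis using has_orthogonal_pair_diagonal[OF gen M] by simp
  next
    case True
    then have "CARD('a) \<in> {25, 31, 37, 43, 61, 67, 73, 79, 97, 103, 109, 121, 127, 139, 151, 157, 163, 169, 181, 193, 199, 211} \<or> CARD('a) \<in> {13, 19, 49}"
    proof -
      have "CARD('a) < 361" using True by simp
      from primepow_below_361[OF q(1) this] show ?thesis
        using q(2-) True by (elim insertE emptyE) (simp_all add: cong_def)
    qed
    then show ?thesis
    proof
      assume "CARD('a) \<in> {25, 31, 37, 43, 61, 67, 73, 79, 97, 103, 109, 121, 127, 139, 151, 157, 163, 169, 181, 193, 199, 211}"
      then have "int CARD('a) \<in> int ` {25, 31, 37, 43, 61, 67, 73, 79, 97, 103, 109, 121, 127, 139, 151, 157, 163, 169, 181, 193, 199, 211}" by (rule imageI)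
      then show ?thesis
        using dvd by (intro pair_table_check_sound[OF gen, where c = 6, OF pair_table_6_6[folded of_nat_numeral[where 'a = int]]]) auto
    next
      assume "CARD('a) \<in> {13, 19, 49}"
      then consider "CARD('a) = 13" | "CARD('a) = 19" | "CARD('a) = 49" by auto
      then show ?thesis
      proof cases
        case 1
        then have p: "of_int 13 = (0::'a)" using card_power_eq_0[where 'a = 'a, of 13 1] by simp
        show ?thesis
          by (rule ext_list_exists[OF gen ext_list_6_6_13 _ p, where \<alpha> = 0 and c = 6]) (use \<open>CARD('a) = 13\<close> in simp_all)
      next
        case 2
        then have p: "of_int 19 = (0::'a)" using card_power_eq_0[where 'a = 'a, of 19 1] by simp
        show ?thesis
          by (rule ext_list_exists[OF gen ext_list_6_6_19 _ p, where \<alpha> = 0 and c = 6]) (use \<open>CARD('a) = 19\<close> in simp_all)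
      next
        case 3
        then have p: "of_int 7 = (0::'a)" using card_power_eq_0[where 'a = 'a, of 7 2] by simp
        obtain \<alpha> :: 'a where root: "\<alpha> * \<alpha> = of_int 3 + of_int 0 * \<alpha>"
          using obtain_square_root[OF gen, of 49 7 3] p \<open>CARD('a) = 49\<close> by auto
        show ?thesis
          by (rule ext_pair_exists[OF gen ext_pair_6_6_49 _ p root, where c = 6]) (use \<open>CARD('a) = 49\<close> in simp_all)
      qed
    qed
  qed
qed

lemma pair_exists_2_4:
  fixes g :: "'a::{field,finite}"
  assumes gen: "field_generator g" and q: "primepow CARD('a)" "[CARD('a) = 1] (mod 4)" "CARD('a) > 7" "CARD('a) \<noteq> 9"
  shows "has_orthogonal_pair g 2 4"
proof -
  have dvd: "4 dvd CARD('a) - 1"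
    using q(2) card_field_gt_1[where 'a = 'a] by (simp add: cong_altdef_nat cong_sym_eq)
  then have M: "4 * ((CARD('a) - 1) div 4) = CARD('a) - 1" by simp
  show ?thesis
  \<comment> \<open>From 78 on, M exceeds c * a^2 + 3 = 19. The later bounds 164 and 344 come from
    27 and 57 in the same way.\<close>
  proof (cases "CARD('a) < 78")
    case False
    then have "19 < (CARD('a) - 1) div 4" using M by linarith
    then show ?thesis
      using False by (intro has_orthogonal_pair_offdiagonal[OF gen M, where a' = 2 and b' = 1]) simp_all
  next
    case True
    then have "CARD('a) \<in> {17, 29, 37, 41, 49, 53, 61, 73} \<or> CARD('a) \<in> {13, 25}"
    proof -
      have "CARD('a) < 361" using True by simp
      from primepow_below_361[OF q(1) this] show ?thesis
        using q(2-) True by (elim insertE emptyE) (simp_all add: cong_def)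
    qed
    then show ?thesis
    proof
      assume "CARD('a) \<in> {17, 29, 37, 41, 49, 53, 61, 73}"
      then have "int CARD('a) \<in> int ` {17, 29, 37, 41, 49, 53, 61, 73}" by (rule imageI)
      then show ?thesis
        using dvd by (intro pair_table_check_sound[OF gen, where c = 4, OF pair_table_2_4[folded of_nat_numeral[where 'a = int]]]) auto
    next
      assume "CARD('a) \<in> {13, 25}"
      then consider "CARD('a) = 13" | "CARD('a) = 25" by auto
      then show ?thesis
      proof cases
        case 1
        then have p: "of_int 13 = (0::'a)" using card_power_eq_0[where 'a = 'a, of 13 1] by simp
        show ?thesis
          by (rule ext_list_exists[OF gen ext_list_2_4_13 _ p, where \<alpha> = 0 and c = 4]) (use \<open>CARD('a) = 13\<close> in simp_all)
      next
        case 2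
        then have p: "of_int 5 = (0::'a)" using card_power_eq_0[where 'a = 'a, of 5 2] by simp
        obtain \<alpha> :: 'a where root: "\<alpha> * \<alpha> = of_int 2 + of_int 0 * \<alpha>"
          using obtain_square_root[OF gen, of 25 5 2] p \<open>CARD('a) = 25\<close> by auto
        show ?thesis
          by (rule ext_pair_exists[OF gen ext_pair_2_4_25 _ p root, where c = 4]) (use \<open>CARD('a) = 25\<close> in simp_all)
      qed
    qed
  qed
qed

lemma pair_exists_2_6:
  fixes g :: "'a::{field,finite}"
  assumes gen: "field_generator g" and q: "primepow CARD('a)" "[CARD('a) = 1] (mod 6)" "CARD('a) > 7" "CARD('a) \<noteq> 13"
  shows "has_orthogonal_pair g 2 6"
proof -
  have dvd: "6 dvd CARD('a) - 1"
    using q(2) card_field_gt_1[where 'a = 'a] by (simp add: cong_altdef_nat cong_sym_eq)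
  then have M: "6 * ((CARD('a) - 1) div 6) = CARD('a) - 1" by simp
  show ?thesis
  proof (cases "CARD('a) < 164")
    case False
    then have "27 < (CARD('a) - 1) div 6" using M by linarith
    then show ?thesis
      using False by (intro has_orthogonal_pair_offdiagonal[OF gen M, where a' = 3 and b' = 1]) simp_all
  next
    case True
    then have "CARD('a) \<in> {25, 31, 37, 43, 61, 67, 73, 79, 97, 103, 109, 121, 127, 139, 151, 157, 163} \<or> CARD('a) \<in> {19, 49}"
    proof -
      have "CARD('a) < 361" using True by simp
      from primepow_below_361[OF q(1) this] show ?thesis
        using q(2-) True by (elim insertE emptyE) (simp_all add: cong_def)
    qed
    then show ?thesis
    proof
      assume "CARD('a) \<in> {25, 31, 37, 43, 61, 67, 73, 79, 97, 103, 109, 121, 127, 139, 151, 157, 163}"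
      then have "int CARD('a) \<in> int ` {25, 31, 37, 43, 61, 67, 73, 79, 97, 103, 109, 121, 127, 139, 151, 157, 163}" by (rule imageI)
      then show ?thesis
        using dvd by (intro pair_table_check_sound[OF gen, where c = 6, OF pair_table_2_6[folded of_nat_numeral[where 'a = int]]]) auto
    next
      assume "CARD('a) \<in> {19, 49}"
      then consider "CARD('a) = 19" | "CARD('a) = 49" by auto
      then show ?thesis
      proof cases
        case 1
        then have p: "of_int 19 = (0::'a)" using card_power_eq_0[where 'a = 'a, of 19 1] by simp
        show ?thesis
          by (rule ext_list_exists[OF gen ext_list_2_6_19 _ p, where \<alpha> = 0 and c = 6]) (use \<open>CARD('a) = 19\<close> in simp_all)
      next
        case 2
        then have p: "of_int 7 = (0::'a)" using card_power_eq_0[where 'a = 'a, of 7 2] by simp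
        obtain \<alpha> :: 'a where root: "\<alpha> * \<alpha> = of_int 3 + of_int 0 * \<alpha>"
          using obtain_square_root[OF gen, of 49 7 3] p \<open>CARD('a) = 49\<close> by auto
        show ?thesis
          by (rule ext_pair_exists[OF gen ext_pair_2_6_49 _ p root, where c = 6]) (use \<open>CARD('a) = 49\<close> in simp_all)
      qed
    qed
  qed
qed

lemma pair_exists_2_3:
  fixes g :: "'a::{field,finite}"
  assumes gen: "field_generator g" and q: "primepow CARD('a)" "[CARD('a) = 1] (mod 6)" "CARD('a) > 7" "CARD('a) \<noteq> 13"
  shows "has_orthogonal_pair g 2 3"
proof -
  have dvd: "6 dvd CARD('a) - 1"
    using q(2) card_field_gt_1[where 'a = 'a] by (simp add: cong_altdef_nat cong_sym_eq)
  then have M: "6 * ((CARD('a) - 1) div 6) = CARD('a) - 1" by simp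
  show ?thesis
  proof (cases "CARD('a) < 164")
    case False
    then have "27 < (CARD('a) - 1) div 6" using M by linarith
    then show ?thesis
      using False by (intro has_orthogonal_pair_offdiagonal[OF gen M, where a' = 3 and b' = 2]) simp_all
  next
    case True
    then have "CARD('a) \<in> {37, 43, 61, 67, 73, 79, 97, 103, 109, 121, 127, 139, 151, 157, 163} \<or> CARD('a) \<in> {19, 25, 31, 49}"
    proof -
      have "CARD('a) < 361" using True by simp
      from primepow_below_361[OF q(1) this] show ?thesis
        using q(2-) True by (elim insertE emptyE) (simp_all add: cong_def)
    qed
    then show ?thesis
    proof
      assume "CARD('a) \<in> {37, 43, 61, 67, 73, 79, 97, 103, 109, 121, 127, 139, 151, 157, 163}"
      then have "int CARD('a) \<in> int ` {37, 43, 61, 67, 73, 79, 97, 103, 109, 121, 127, 139, 151, 157, 163}" by (rule imageI)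
      then show ?thesis
        using dvd by (intro pair_table_check_sound[OF gen, where c = 6, OF pair_table_2_3[folded of_nat_numeral[where 'a = int]]]) auto
    next
      assume "CARD('a) \<in> {19, 25, 31, 49}"
      then consider "CARD('a) = 19" | "CARD('a) = 25" | "CARD('a) = 31" | "CARD('a) = 49" by auto
      then show ?thesis
      proof cases
        case 1
        then have p: "of_int 19 = (0::'a)" using card_power_eq_0[where 'a = 'a, of 19 1] by simp
        show ?thesis
          by (rule ext_list_exists[OF gen ext_list_2_3_19 _ p, where \<alpha> = 0 and c = 6]) (use \<open>CARD('a) = 19\<close> in simp_all)
      next
        case 2
        then have p: "of_int 5 = (0::'a)" using card_power_eq_0[where 'a = 'a, of 5 2] by simp
        obtain \<alpha> :: 'a where root: "\<alpha> * \<alpha> = of_int 2 + of_int 0 * \<alpha>"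
          using obtain_square_root[OF gen, of 25 5 2] p \<open>CARD('a) = 25\<close> by auto
        show ?thesis
          by (rule ext_pair_exists[OF gen ext_pair_2_3_25 _ p root, where c = 6]) (use \<open>CARD('a) = 25\<close> in simp_all)
      next
        case 3
        then have p: "of_int 31 = (0::'a)" using card_power_eq_0[where 'a = 'a, of 31 1] by simp
        show ?thesis
          by (rule ext_list_exists[OF gen ext_list_2_3_31 _ p, where \<alpha> = 0 and c = 6]) (use \<open>CARD('a) = 31\<close> in simp_all)
      next
        case 4
        then have p: "of_int 7 = (0::'a)" using card_power_eq_0[where 'a = 'a, of 7 2] by simp
        obtain \<alpha> :: 'a where root: "\<alpha> * \<alpha> = of_int 3 + of_int 0 * \<alpha>"
          using obtain_square_root[OF gen, of 49 7 3] p \<open>CARD('a) = 49\<close> by auto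
        show ?thesis
          by (rule ext_pair_exists[OF gen ext_pair_2_3_49 _ p root, where c = 6]) (use \<open>CARD('a) = 49\<close> in simp_all)
      qed
    qed
  qed
qed

lemma pair_exists_3_6:
  fixes g :: "'a::{field,finite}"
  assumes gen: "field_generator g" and q: "primepow CARD('a)" "[CARD('a) = 1] (mod 6)" "CARD('a) > 7"
  shows "has_orthogonal_pair g 3 6"
proof -
  have dvd: "6 dvd CARD('a) - 1"
    using q(2) card_field_gt_1[where 'a = 'a] by (simp add: cong_altdef_nat cong_sym_eq)
  then have M: "6 * ((CARD('a) - 1) div 6) = CARD('a) - 1" by simp
  show ?thesis
  proof (cases "CARD('a) < 344")
    case False
    then have "57 < (CARD('a) - 1) div 6" using M by linarith
    then show ?thesis
      using False by (intro has_orthogonal_pair_offdiagonal[OF gen M, where a' = 2 and b' = 1]) simp_all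
  next
    case True
    then have "CARD('a) \<in> {25, 31, 37, 43, 61, 67, 73, 79, 97, 103, 109, 121, 127, 139, 151, 157, 163, 181, 193, 199, 211, 223, 229, 241, 271, 277, 283, 289, 307, 313, 331, 337} \<or> CARD('a) \<in> {13, 19, 49, 169, 343}"
    proof -
      have "CARD('a) < 361" using True by simp
      from primepow_below_361[OF q(1) this] show ?thesis
        using q(2-) True by (elim insertE emptyE) (simp_all add: cong_def)
    qed
    then show ?thesis
    proof
      assume "CARD('a) \<in> {25, 31, 37, 43, 61, 67, 73, 79, 97, 103, 109, 121, 127, 139, 151, 157, 163, 181, 193, 199, 211, 223, 229, 241, 271, 277, 283, 289, 307, 313, 331, 337}"
      then have "int CARD('a) \<in> int ` {25, 31, 37, 43, 61, 67, 73, 79, 97, 103, 109, 121, 127, 139, 151, 157, 163, 181, 193, 199, 211, 223, 229, 241, 271, 277, 283, 289, 307, 313, 331, 337}" by (rule imageI)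
      then show ?thesis
        using dvd by (intro pair_table_check_sound[OF gen, where c = 6, OF pair_table_3_6[folded of_nat_numeral[where 'a = int]]]) auto
    next
      assume "CARD('a) \<in> {13, 19, 49, 169, 343}"
      then consider "CARD('a) = 13" | "CARD('a) = 19" | "CARD('a) = 49" | "CARD('a) = 169" | "CARD('a) = 343" by auto
      then show ?thesis
      proof cases
        case 1
        then have p: "of_int 13 = (0::'a)" using card_power_eq_0[where 'a = 'a, of 13 1] by simp
        show ?thesis
          by (rule ext_list_exists[OF gen ext_list_3_6_13 _ p, where \<alpha> = 0 and c = 6]) (use \<open>CARD('a) = 13\<close> in simp_all)
      next
        case 2
        then have p: "of_int 19 = (0::'a)" using card_power_eq_0[where 'a = 'a, of 19 1] by simp
        show ?thesis
          by (rule ext_list_exists[OF gen ext_list_3_6_19 _ p, where \<alpha> = 0 and c = 6]) (use \<open>CARD('a) = 19\<close> in simp_all)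
      next
        case 3
        then have p: "of_int 7 = (0::'a)" using card_power_eq_0[where 'a = 'a, of 7 2] by simp
        obtain \<alpha> :: 'a where root: "\<alpha> * \<alpha> = of_int 3 + of_int 0 * \<alpha>"
          using obtain_square_root[OF gen, of 49 7 3] p \<open>CARD('a) = 49\<close> by auto
        show ?thesis
          by (rule ext_pair_exists[OF gen ext_pair_3_6_49 _ p root, where c = 6]) (use \<open>CARD('a) = 49\<close> in simp_all)
      next
        case 4
        then have p: "of_int 13 = (0::'a)" using card_power_eq_0[where 'a = 'a, of 13 2] by simp
        obtain \<alpha> :: 'a where root: "\<alpha> * \<alpha> = of_int 2 + of_int 0 * \<alpha>"
          using obtain_square_root[OF gen, of 169 13 2] p \<open>CARD('a) = 169\<close> by auto
        show ?thesis
          by (rule ext_pair_exists[OF gen ext_pair_3_6_169 _ p root, where c = 6]) (use \<open>CARD('a) = 169\<close> in simp_all)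
      next
        case 5
        then show ?thesis by (rule has_orthogonal_pair_343[OF gen])
      qed
    qed
  qed
qed

section \<open>Nonexistence\<close>

text \<open>Multiplication by a constant has index 1, so a least index above 1 excludes it.\<close>

lemma least_indexD:
  fixes g :: "'a::{field,finite}"
  assumes gen: "field_generator g" and \<theta>: "\<theta> \<in> least_index_orthomorphisms g a"
    and a: "a * M = CARD('a) - 1" "1 < a"
  shows "index_map M \<theta>" "\<theta> 0 = 0" "\<not> (\<exists>k. \<forall>y. \<theta> y = k * y)"
    and "l * N = CARD('a) - 1 \<Longrightarrow> l < a \<Longrightarrow> \<not> index_map N \<theta>"
proof -
  have orth: "orthomorphism \<theta>" and ind: "index_map M \<theta>"
    using \<theta> cyclotomic_orthomorphisms_iff[OF gen a(1)] by (auto simp: least_index_orthomorphisms_def)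
  show "index_map M \<theta>" by fact
  show "\<theta> 0 = 0" using ind by (simp add: index_map_def)
  show least: "\<not> index_map N \<theta>" if l: "l * N = CARD('a) - 1" "l < a" for l N
  proof
    assume "index_map N \<theta>"
    then have "\<theta> \<in> cyclotomic_orthomorphisms g l"
      using cyclotomic_orthomorphisms_iff[OF gen l(1)] orth by simp
    moreover have "l dvd CARD('a) - 1" using l(1) by (metis dvd_triv_left)
    ultimately show False using \<theta> l(2) by (auto simp: least_index_orthomorphisms_def)
  qed
  show "\<not> (\<exists>k. \<forall>y. \<theta> y = k * y)"
  proof
    assume "\<exists>k. \<forall>y. \<theta> y = k * y"
    then obtain k where "\<And>y. \<theta> y = k * y" by blast
    then have "index_map (CARD('a) - 1) \<theta>" by (simp add: index_map_def)
    then show False using least[of 1 "CARD('a) - 1"] a(2) by simp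
  qed
qed

text \<open>For even M, x and -x have the same M-th power and hence the same multiplier.\<close>

lemma index_map_odd:
  assumes "index_map M \<theta>" "even M"
  shows "\<forall>x. \<theta> (- x) = - \<theta> x"
proof
  fix x show "\<theta> (- x) = - \<theta> x"
  proof (cases "x = 0")
    case False
    then have "\<theta> (- x) * x = \<theta> x * - x"
      using assms unfolding index_map_def by (metis neg_equal_0_iff_equal power_minus_even)
    then have "\<theta> (- x) * x = (- \<theta> x) * x" by simp
    then show ?thesis using False by (metis mult_right_cancel)
  qed (use assms in \<open>simp add: index_map_def\<close>)
qed

lemma no_pair_if_search_fails:
  fixes g \<alpha> :: "'a::{field,finite}"
  assumes gen: "field_generator g"
    and ext: "of_int p = (0::'a)" "\<alpha> * \<alpha> = of_int d + of_int e * \<alpha>" "p > 0"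
    and check: "no_nonlinear_pair p d e xs" "ext_nonzero p d e q (ext_differences p (elements p False xs))"
    and q: "q \<ge> 2" "length (elements p False xs) = CARD('a)"
    and ab: "a dvd CARD('a) - 1" "b dvd CARD('a) - 1" "1 < a" "1 < b"
  shows "\<not> has_orthogonal_pair g a b"
proof
  assume "has_orthogonal_pair g a b"
  then obtain \<theta> \<theta>' where \<theta>: "\<theta> \<in> least_index_orthomorphisms g a"
    "\<theta>' \<in> least_index_orthomorphisms g b" "orthogonal_orthomorphisms \<theta> \<theta>'"
    unfolding has_orthogonal_pair_def by blast
  obtain M N where "a * M = CARD('a) - 1" "b * N = CARD('a) - 1" using ab by (metis dvdE)
  then have "\<theta> 0 = 0" "\<theta>' 0 = 0" "\<not> (\<exists>k. \<forall>y. \<theta> y = k * y)" "\<not> (\<exists>k. \<forall>y. \<theta>' y = k * y)"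
    using least_indexD[OF gen \<theta>(1)] least_indexD[OF gen \<theta>(2)] ab by blast+
  then show False
    using no_nonlinear_pair_sound[OF ext check(1) representativesI[OF ext check(2) q] \<theta>(3)] by blast
qed

text \<open>The search leaves two possibilities: \<theta> is linear, against its least index 2, or
  the other map has index 2, against 2 < b. Both M and N are even, so both maps are odd and a search
  over representatives up to sign is sound.\<close>

lemma no_quadratic_pair_if_search_fails:
  fixes g \<alpha> :: "'a::{field,finite}"
  assumes gen: "field_generator g"
    and ext: "of_int p = (0::'a)" "\<alpha> * \<alpha> = of_int d + of_int e * \<alpha>" "p > 0"
    and check: "quadratic_check p d e xs ys (elements p True (xs @ ys)) (elements p True (xs @ ys))"
      "ext_nonzero p d e q (ext_differences p (elements p True (xs @ ys)))"
      "all_powers p d e (int M) (1, 0) xs" "all_powers p d e (int M) (p - 1, 0) ys"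
    and q: "q \<ge> 2" "length (elements p True (xs @ ys)) = CARD('a)" and two: "(1::'a) \<noteq> -1"
    and M: "2 * M = CARD('a) - 1" "even M" and N: "b * N = CARD('a) - 1" "even N" and b: "2 < b"
  shows "\<not> has_orthogonal_pair g 2 b"
proof
  assume "has_orthogonal_pair g 2 b"
  then obtain \<theta> \<theta>' where \<theta>: "\<theta> \<in> least_index_orthomorphisms g 2"
    "\<theta>' \<in> least_index_orthomorphisms g b" "orthogonal_orthomorphisms \<theta> \<theta>'"
    unfolding has_orthogonal_pair_def by blast
  note D = least_indexD[OF gen \<theta>(1) M(1)] and D' = least_indexD[OF gen \<theta>(2) N(1)]
  have "M > 0" using index_factors_pos[OF M(1)] by simp
  note reps = representativesI[OF ext check(2) q]
  have odd: "\<forall>x. \<theta> (- x) = - \<theta> x" "\<forall>x. \<theta>' (- x) = - \<theta>' x"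
    using index_map_odd D(1) D'(1) M(2) N(2) b by simp_all
  note quad = quadratic_index_map[OF ext reps M(2) \<open>M > 0\<close> check(3,4) two]
  obtain m m' where m: "\<forall>x\<in>set xs. \<theta> (ext_value \<alpha> x) = m * ext_value \<alpha> x"
    "\<forall>x\<in>set ys. \<theta> (ext_value \<alpha> x) = m' * ext_value \<alpha> x"
    using quad[of \<theta>] D odd by auto
  have "\<not> index_map M \<theta>'" using D'(4)[OF _ M(1)] b by simp
  then show False
    using quadratic_check_sound[OF ext check(1) reps \<theta>(3) _ _ odd m] quad[of \<theta>'] D D' odd b by auto
qed

lemma no_pair_up_to_7:
  fixes g :: "'a::{field,finite}"
  assumes gen: "field_generator g" and q: "primepow CARD('a)" "CARD('a) \<le> 7"
    and ab: "a dvd CARD('a) - 1" "b dvd CARD('a) - 1" "1 < a" "1 < b"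
  shows "\<not> has_orthogonal_pair g a b"
proof -
  have "CARD('a) \<in> {2, 3, 4, 5, 7}" using primepow_below_361[OF q(1)] q(2) by auto
  \<comment> \<open>For q = 2, a > 1 would have to divide 1.\<close>
  moreover have "CARD('a) \<noteq> 2" using ab by auto
  ultimately consider "CARD('a) = 3" | "CARD('a) = 4" | "CARD('a) = 5" | "CARD('a) = 7" by auto
  then show ?thesis
  proof cases
    case 1
    then have p: "of_int 3 = (0::'a)" using card_power_eq_0[where 'a = 'a, of 3 1] by simp
    show ?thesis
      by (rule no_pair_if_search_fails[OF gen p _ _ no_nonlinear_pair_3 distinct_elements_3, where \<alpha> = 0])
         (use 1 ab in \<open>simp_all add: elements_def\<close>)
  next
    case 2
    then have p: "of_int 2 = (0::'a)" using card_power_eq_0[where 'a = 'a, of 2 2] by simp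
    obtain \<alpha> :: 'a where root: "\<alpha> * \<alpha> = of_int 1 + of_int 1 * \<alpha>"
      using obtain_cube_root_of_unity[OF gen, of 2] 2 by auto
    show ?thesis
      by (rule no_pair_if_search_fails[OF gen p root _ no_nonlinear_pair_4 distinct_elements_4])
         (use 2 ab in \<open>simp_all add: elements_def\<close>)
  next
    case 3
    then have p: "of_int 5 = (0::'a)" using card_power_eq_0[where 'a = 'a, of 5 1] by simp
    show ?thesis
      by (rule no_pair_if_search_fails[OF gen p _ _ no_nonlinear_pair_5 distinct_elements_5, where \<alpha> = 0])
         (use 3 ab in \<open>simp_all add: elements_def\<close>)
  next
    case 4
    then have p: "of_int 7 = (0::'a)" using card_power_eq_0[where 'a = 'a, of 7 1] by simp
    show ?thesis
      by (rule no_pair_if_search_fails[OF gen p _ _ no_nonlinear_pair_7 distinct_elements_7, where \<alpha> = 0])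
         (use 4 ab in \<open>simp_all add: elements_def\<close>)
  qed
qed

lemma one_neq_minus_one_if_odd_card:
  assumes "odd CARD('a::{field,finite})"
  shows "(1::'a) \<noteq> -1"
proof
  assume "(1::'a) = -1"
  then have "(2::'a) = 0" by (metis add.right_inverse one_add_one)
  then have "of_nat 2 = (0::'a)" by simp
  then have "CHAR('a) dvd 2" by (simp only: of_nat_eq_0_iff_char_dvd)
  moreover have "CHAR('a) \<noteq> 1" using CHAR_not_1' by simp
  ultimately have "CHAR('a) = 2" using two_is_prime_nat by (metis prime_nat_iff)
  then show False using CHAR_dvd_CARD[where 'a = 'a] assms by simp
qed

lemma no_pair_9:
  fixes g :: "'a::{field,finite}"
  assumes gen: "field_generator g" and q: "CARD('a) = 9"
  shows "\<not> has_orthogonal_pair g 2 4"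
proof -
  have p: "of_int 3 = (0::'a)" using card_power_eq_0[where 'a = 'a, of 3 2] q by simp
  obtain \<alpha> :: 'a where root: "\<alpha> * \<alpha> = of_int 2 + of_int 0 * \<alpha>"
    using obtain_square_root[OF gen, of 9 3 2] p q by auto
  have two: "(1::'a) \<noteq> -1" using one_neq_minus_one_if_odd_card[where 'a = 'a] q by simp
  show ?thesis
    by (rule no_quadratic_pair_if_search_fails[OF gen p root _ quadratic_check_9 distinct_elements_9 _ _ _ _ two,
          where M = 4 and N = 2])
       (use q quadratic_characters_9 in \<open>simp_all add: elements_def\<close>)
qed

lemma no_pair_13:
  fixes g :: "'a::{field,finite}"
  assumes gen: "field_generator g" and q: "CARD('a) = 13" and b: "b = 3 \<or> b = 6"
  shows "\<not> has_orthogonal_pair g 2 b"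
proof -
  have p: "of_int 13 = (0::'a)" using card_power_eq_0[where 'a = 'a, of 13 1] q by simp
  have two: "(1::'a) \<noteq> -1" using one_neq_minus_one_if_odd_card[where 'a = 'a] q by simp
  show ?thesis
    by (rule no_quadratic_pair_if_search_fails[OF gen p _ _ quadratic_check_13 distinct_elements_13 _ _ _ _ two,
          where M = 6 and N = "12 div b" and \<alpha> = 0])
       (use q b quadratic_characters_13 in \<open>auto simp: elements_def\<close>)
qed

theorem theorem4p8:
  fixes a b c q :: nat and g :: "'a::{field,finite}"
  assumes "1 < a" and "a \<le> b"
    and "c = lcm a b" and "c \<le> 6"
    and "primepow q" and "[q = 1] (mod c)"
    and "CARD('a) = q"
    and "field_generator g"
  shows "(\<exists>\<theta>\<in>least_index_orthomorphisms g a. \<exists>\<theta>'\<in>least_index_orthomorphisms g b.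
            orthogonal_orthomorphisms \<theta> \<theta>')
         \<longleftrightarrow> q > 7 \<and> (q, a, b) \<notin> {(9, 2, 4), (13, 2, 3), (13, 2, 6)}"
proof -
  note gen = assms(8)
  have pp: "primepow CARD('a)" using assms(5,7) by simp
  have cong: "[CARD('a) = 1] (mod c)" using assms(6,7) by simp
  have dvd: "c dvd CARD('a) - 1"
    using cong card_field_gt_1[where 'a = 'a] by (simp add: cong_altdef_nat cong_sym_eq)
  then have ab_dvd: "a dvd CARD('a) - 1" "b dvd CARD('a) - 1"
    using assms(3) by (metis dvd_lcm1 dvd_trans, metis dvd_lcm2 dvd_trans)
  have "b \<le> c" using assms(1-3) by (intro dvd_imp_le) (auto simp: lcm_pos_nat)
  then have range: "a \<in> {2, 3, 4, 5, 6}" "b \<in> {2, 3, 4, 5, 6}" using assms(1,2,4) by auto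
  have lcms: "lcm 2 (5::nat) = 10" "lcm 3 (4::nat) = 12" "lcm 3 (5::nat) = 15" "lcm 4 (5::nat) = 20"
    "lcm 4 (6::nat) = 12" "lcm 5 (6::nat) = 30" "lcm 2 (3::nat) = 6" "lcm 2 (4::nat) = 4"
    "lcm 2 (6::nat) = 6" "lcm 3 (6::nat) = 6"
    by code_simp+
  \<comment> \<open>Of the fifteen pairs with 2 \<le> a \<le> b \<le> 6, six have a least common
    multiple above 6.\<close>
  have cases: "(a, b, c) \<in> {(2, 2, 2), (3, 3, 3), (4, 4, 4), (5, 5, 5), (6, 6, 6), (2, 4, 4), (2, 6, 6),
      (3, 6, 6), (2, 3, 6)}"
    using range assms(2,4) unfolding assms(3) by (elim insertE emptyE) (simp_all add: lcms)
  have "has_orthogonal_pair g a b" if "CARD('a) > 7" "(CARD('a), a, b) \<notin> {(9, 2, 4), (13, 2, 3), (13, 2, 6)}"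
    using cases cong that pair_exists_2_2[OF gen pp] pair_exists_3_3[OF gen pp] pair_exists_4_4[OF gen pp]
      pair_exists_5_5[OF gen pp] pair_exists_6_6[OF gen pp] pair_exists_2_4[OF gen pp]
      pair_exists_2_6[OF gen pp] pair_exists_2_3[OF gen pp] pair_exists_3_6[OF gen pp]
    by auto
  moreover have "\<not> has_orthogonal_pair g a b" if "\<not> CARD('a) > 7"
    using no_pair_up_to_7[OF gen pp _ ab_dvd] that assms(1,2) by simp
  moreover have "\<not> has_orthogonal_pair g a b" if "(CARD('a), a, b) \<in> {(9, 2, 4), (13, 2, 3), (13, 2, 6)}"
    using no_pair_9[OF gen] no_pair_13[OF gen, of b] that by auto
  ultimately show ?thesis
    unfolding has_orthogonal_pair_def assms(7) by blast
qed

end
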